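(* (Generalized Waring Formula) Let $n$ and $k$ be two positive integers. Then in the ring of symmetric functions, $$p_n\circ e_k=(-1)^{k(n-1)}\sum_{\lambda}\det(\mathcal{M}(\lambda))\,\det\big(e_{\lambda_i+j-i}\big)_{i,j=1}^{\ell(\lambda)},$$ where the sum is over all partitions $\lambda\vdash nk$ with $\ell(\lambda)\le n$ such that $\lambda$ (viewed as the skew diagram $\lambda/\varnothing$) is a horizontal $n$-border strip of weight $k$.
   Context: $p_n$ and $e_k$ are the power sum and elementary symmetric functions in infinitely many variables $x_1,x_2,\ldots$, with $e_0=1$ and $e_r=0$ for $r<0$. The plethysm $p_n\circ e_k$ is $e_k(x_1^n,x_2^n,\ldots)$. $\ell(\lambda)$ is the number of nonzero parts of $\lambda$. Young diagrams are drawn with rows numbered from top to bottom and columns from left to right. Matrix: $\mathcal{M}(\lambda)=\mathcal{M}(\lambda/\varnothing)=(m_{ij})$ is the $\ell(\lambda)\times\ell(\lambda)$ matrix with $m_{ij}=1$ if $\lambda_i-i\ge -j$ and $n\mid(\lambda_i-i+j)$, and $m_{ij}=0$ otherwise. Border strips: a skew diagram is an $r$-border strip if it consists of $r$ boxes, is connected and contains no $2\times 2$ square. Its starting box is its northeasternmost box. For partitions $\mu\subset\lambda$, $(\lambda/\mu)\!\uparrow$ is the set consisting of the top box of each (nonempty) column of $\lambda/\mu$. Horizontal $n$-border strip: $\lambda/\mu$ is a horizontal $n$-border strip of weight $k$ if there is a chain of partitions $\mu=\alpha^{(0)}\subset\alpha^{(1)}\subset\cdots\subset\alpha^{(k)}=\lambda$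 such that each $\alpha^{(i)}/\alpha^{(i-1)}$ is an $n$-border strip, the starting box of each $\alpha^{(i)}/\alpha^{(i-1)}$ lies in $(\lambda/\mu)\!\uparrow$, and for $i<j$ the starting box of $\alpha^{(i)}/\alpha^{(i-1)}$ lies southwest (weakly below and strictly to the left) of the starting box of $\alpha^{(j)}/\alpha^{(j-1)}$. *)

theory Defs
  imports "HOL-Library.Poly_Mapping" "Jordan_Normal_Form.Determinant"
begin

section \<open>The ring of symmetric functions\<close>

text \<open>
  A monomial in the variables \<open>x\<^sub>0, x\<^sub>1, \<dots>\<close> is represented by its finitely supported exponent
  sequence. The ring of symmetric functions with integer coefficients consists of the formal
  power series of bounded degree that are invariant under all permutations of the variables.
\<close>

type_synonym monomial = "nat \<Rightarrow>\<^sub>0 nat"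

definition monomial_degree :: "monomial \<Rightarrow> nat" where
  "monomial_degree m = (\<Sum>i\<in>Poly_Mapping.keys m. Poly_Mapping.lookup m i)"

definition permute_vars :: "(nat \<Rightarrow> nat) \<Rightarrow> monomial \<Rightarrow> monomial" where
  "permute_vars \<pi> m = Poly_Mapping.map_key \<pi> m"

definition series_mult :: "(monomial \<Rightarrow> int) \<Rightarrow> (monomial \<Rightarrow> int) \<Rightarrow> monomial \<Rightarrow> int" where
  "series_mult f g m = (\<Sum>(a, b) | a + b = m. f a * g b)"

definition bounded_degree :: "(monomial \<Rightarrow> int) \<Rightarrow> bool" where
  "bounded_degree f \<longleftrightarrow> (\<exists>d. \<forall>m. f m \<noteq> 0 \<longrightarrow> monomial_degree m \<le> d)"

definition symmetric_series :: "(monomial \<Rightarrow> int) \<Rightarrow> bool" where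
  "symmetric_series f \<longleftrightarrow> (\<forall>\<pi> m. bij \<pi> \<longrightarrow> f (permute_vars \<pi> m) = f m)"

subsection \<open>Closure properties\<close>

lemma monomial_eqI: "(\<And>i. Poly_Mapping.lookup a i = Poly_Mapping.lookup b i) \<Longrightarrow> a = (b :: monomial)"
  by (rule poly_mapping_eqI)

lemma lookup_permute_vars:
  "bij \<pi> \<Longrightarrow> Poly_Mapping.lookup (permute_vars \<pi> m) i = Poly_Mapping.lookup m (\<pi> i)"
  unfolding permute_vars_def by (simp add: map_key.rep_eq bij_is_inj)

lemma permute_vars_plus:
  "bij \<pi> \<Longrightarrow> permute_vars \<pi> (a + b) = permute_vars \<pi> a + permute_vars \<pi> b"
  by (rule monomial_eqI) (simp add: lookup_permute_vars lookup_add)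

lemma permute_vars_inv:
  assumes "bij \<pi>"
  shows "permute_vars \<pi> (permute_vars (inv_into UNIV \<pi>) m) = m"
    and "permute_vars (inv_into UNIV \<pi>) (permute_vars \<pi> m) = m"
  using assms bij_imp_bij_inv[OF assms]
  by (auto intro!: monomial_eqI simp: lookup_permute_vars bij_is_inj bij_is_surj surj_f_inv_f)

lemma bij_betw_keys_permute_vars:
  assumes "bij \<pi>"
  shows "bij_betw \<pi> (Poly_Mapping.keys (permute_vars \<pi> m)) (Poly_Mapping.keys m)"
proof (rule bij_betw_imageI)
  show "inj_on \<pi> (Poly_Mapping.keys (permute_vars \<pi> m))"
    using bij_is_inj[OF assms] by (rule inj_on_subset) simp
  show "\<pi> ` Poly_Mapping.keys (permute_vars \<pi> m) = Poly_Mapping.keys m"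
  proof
    show "Poly_Mapping.keys m \<subseteq> \<pi> ` Poly_Mapping.keys (permute_vars \<pi> m)"
    proof
      fix i assume "i \<in> Poly_Mapping.keys m"
      moreover obtain j where "i = \<pi> j"
        using bij_is_surj[OF assms] by (rule surjE)
      ultimately show "i \<in> \<pi> ` Poly_Mapping.keys (permute_vars \<pi> m)"
        by (simp add: in_keys_iff lookup_permute_vars[OF assms])
    qed
  qed (auto simp: in_keys_iff lookup_permute_vars[OF assms])
qed

lemma monomial_degree_permute_vars:
  assumes "bij \<pi>"
  shows "monomial_degree (permute_vars \<pi> m) = monomial_degree m"
  unfolding monomial_degree_def lookup_permute_vars[OF assms]
  by (rule sum.reindex_bij_betw[OF bij_betw_keys_permute_vars[OF assms]])

lemma monomial_degree_plus: "monomial_degree (a + b) = monomial_degree a + monomial_degree b"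
proof -
  let ?S = "Poly_Mapping.keys a \<union> Poly_Mapping.keys b"
  have *: "monomial_degree c = (\<Sum>i\<in>?S. Poly_Mapping.lookup c i)"
    if "Poly_Mapping.keys c \<subseteq> ?S" for c
    unfolding monomial_degree_def
    by (rule sum.mono_neutral_left) (use that in \<open>auto simp: in_keys_iff\<close>)
  have "Poly_Mapping.keys (a + b) \<subseteq> ?S"
    by (rule Poly_Mapping.keys_add)
  then show ?thesis
    by (simp add: * lookup_add sum.distrib)
qed

lemma finite_monomial_divisors: "finite {a :: monomial. \<exists>b. a + b = m}"
proof -
  let ?F = "{h. \<forall>i. (i \<in> Poly_Mapping.keys m \<longrightarrow> h i \<in> {..Max (range (Poly_Mapping.lookup m))}) \<and>
                   (i \<notin> Poly_Mapping.keys m \<longrightarrow> h i = (0::nat))}"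
  have fin: "finite (range (Poly_Mapping.lookup m))"
  proof (rule finite_subset)
    show "range (Poly_Mapping.lookup m) \<subseteq> insert 0 (Poly_Mapping.lookup m ` Poly_Mapping.keys m)"
      by (auto simp: in_keys_iff)
  qed simp
  have "Poly_Mapping.lookup ` {a. \<exists>b. a + b = m} \<subseteq> ?F"
  proof safe
    fix a b :: monomial and i assume m: "m = a + b"
    have "Poly_Mapping.lookup a i \<le> Poly_Mapping.lookup (a + b) i"
      by (simp add: lookup_add)
    also have "\<dots> \<le> Max (range (Poly_Mapping.lookup (a + b)))"
      using fin unfolding m by (intro Max_ge) auto
    finally show "Poly_Mapping.lookup a i \<le> Max (range (Poly_Mapping.lookup (a + b)))" .
    assume "i \<notin> Poly_Mapping.keys (a + b)"
    then show "Poly_Mapping.lookup a i = 0"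
      by (simp add: in_keys_iff lookup_add)
  qed
  moreover have "finite ?F"
    by (rule finite_set_of_finite_funs) auto
  ultimately have "finite (Poly_Mapping.lookup ` {a. \<exists>b. a + b = m})"
    using finite_subset by blast
  then show ?thesis
    by (rule finite_imageD) (auto intro: inj_onI monomial_eqI)
qed

lemma finite_splittings: "finite {(a, b). a + b = (m :: monomial)}"
proof (rule finite_subset)
  show "{(a, b). a + b = m} \<subseteq> {a. \<exists>b. a + b = m} \<times> {a. \<exists>b. a + b = m}"
    by auto (metis add.commute)
qed (simp add: finite_monomial_divisors)

lemma finite_splittings': "finite {p. fst p + snd p = (m :: monomial)}"
  using finite_splittings[of m] by (simp add: case_prod_unfold)

lemma series_mult_commute: "series_mult f g = series_mult g f"
  unfolding series_mult_def
  by (intro ext sum.reindex_bij_witness[of _ prod.swap prod.swap]) (auto simp: add.commute)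

lemma series_mult_assoc: "series_mult (series_mult f g) h = series_mult f (series_mult g h)"
proof
  fix m
  have "series_mult (series_mult f g) h m =
      (\<Sum>x\<in>{(p, c). p + c = m}. \<Sum>y\<in>{(a, b). a + b = fst x}. f (fst y) * g (snd y) * h (snd x))"
    by (simp add: series_mult_def sum_distrib_right case_prod_unfold)
  also have "\<dots> = (\<Sum>z\<in>(SIGMA x:{(p, c). p + c = m}. {(a, b). a + b = fst x}).
      f (fst (snd z)) * g (snd (snd z)) * h (snd (fst z)))"
    by (subst sum.Sigma) (auto simp: finite_splittings' case_prod_unfold)
  also have "\<dots> = (\<Sum>z\<in>(SIGMA x:{(a, q). a + q = m}. {(b, c). b + c = snd x}).
      f (fst (fst z)) * (g (fst (snd z)) * h (snd (snd z))))"
    by (rule sum.reindex_bij_witness[of _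
          "\<lambda>((a, q), (b, c)). ((a + b, c), (a, b))" "\<lambda>((p, c), (a, b)). ((a, b + c), (b, c))"])
      (auto simp: add.assoc mult.assoc)
  also have "\<dots> = (\<Sum>x\<in>{(a, q). a + q = m}. \<Sum>y\<in>{(b, c). b + c = snd x}.
      f (fst x) * (g (fst y) * h (snd y)))"
    by (subst sum.Sigma) (auto simp: finite_splittings' case_prod_unfold)
  also have "\<dots> = series_mult f (series_mult g h) m"
    by (simp add: series_mult_def sum_distrib_left case_prod_unfold)
  finally show "series_mult (series_mult f g) h m = series_mult f (series_mult g h) m" .
qed

lemma series_mult_one: "series_mult (\<lambda>m. if m = 0 then 1 else 0) f = f"
proof
  fix m
  have "series_mult (\<lambda>m. if m = 0 then 1 else 0) f m =
      (\<Sum>(a, b)\<in>{(0 :: monomial, m)}. (if a = 0 then 1 else 0) * f b)"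
    unfolding series_mult_def
    by (intro sum.mono_neutral_right finite_splittings) (auto split: if_splits)
  then show "series_mult (\<lambda>m. if m = 0 then 1 else 0) f m = f m" by simp
qed

lemma series_mult_distrib:
  "series_mult (\<lambda>m. f m + g m) h m = series_mult f h m + series_mult g h m"
  by (simp add: series_mult_def case_prod_unfold distrib_right sum.distrib)

lemma bounded_degree_add:
  assumes "bounded_degree f" "bounded_degree g"
  shows "bounded_degree (\<lambda>m. f m + g m)"
proof -
  from assms obtain d e where "\<And>m. f m \<noteq> 0 \<Longrightarrow> monomial_degree m \<le> d"
      "\<And>m. g m \<noteq> 0 \<Longrightarrow> monomial_degree m \<le> e"
    unfolding bounded_degree_def by blast
  then show ?thesis
    unfolding bounded_degree_def
    by (intro exI[of _ "max d e"]) (metis add.right_neutral max.coboundedI1 max.coboundedI2)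
qed

lemma bounded_degree_mult:
  assumes "bounded_degree f" "bounded_degree g"
  shows "bounded_degree (series_mult f g)"
proof -
  from assms obtain d e where *: "\<And>m. f m \<noteq> 0 \<Longrightarrow> monomial_degree m \<le> d"
      "\<And>m. g m \<noteq> 0 \<Longrightarrow> monomial_degree m \<le> e"
    unfolding bounded_degree_def by blast
  have "monomial_degree m \<le> d + e" if nz: "series_mult f g m \<noteq> 0" for m
  proof -
    obtain p where "p \<in> {(a, b). a + b = m}" "(case p of (a, b) \<Rightarrow> f a * g b) \<noteq> 0"
      using nz unfolding series_mult_def by (rule sum.not_neutral_contains_not_neutral)
    then obtain a b where "a + b = m" "f a \<noteq> 0" "g b \<noteq> 0"
      by auto
    with * show ?thesis
      by (metis add_mono monomial_degree_plus)
  qed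
  then show ?thesis unfolding bounded_degree_def by blast
qed

lemma symmetric_series_mult:
  assumes "symmetric_series f" "symmetric_series g"
  shows "symmetric_series (series_mult f g)"
  unfolding symmetric_series_def
proof (intro allI impI)
  fix \<pi> :: "nat \<Rightarrow> nat" and m assume \<pi>: "bij \<pi>"
  show "series_mult f g (permute_vars \<pi> m) = series_mult f g m"
    unfolding series_mult_def
    using \<pi> assms bij_imp_bij_inv[OF \<pi>]
    by (intro sum.reindex_bij_witness[of _ "map_prod (permute_vars \<pi>) (permute_vars \<pi>)"
          "map_prod (permute_vars (inv_into UNIV \<pi>)) (permute_vars (inv_into UNIV \<pi>))"])
      (auto simp: permute_vars_inv permute_vars_plus[symmetric] symmetric_series_def)
qed

lemma permute_vars_eq_0_iff: "bij \<pi> \<Longrightarrow> permute_vars \<pi> m = 0 \<longleftrightarrow> m = 0"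
  using bij_betw_keys_permute_vars[of \<pi> m]
  by (metis bij_betw_empty1 bij_betw_empty2 keys_eq_empty)

subsection \<open>The ring structure\<close>

typedef symfun = "{f :: monomial \<Rightarrow> int. bounded_degree f \<and> symmetric_series f}"
  morphisms coefficient Abs_symfun
  by (rule exI[of _ "\<lambda>_. 0"]) (simp add: bounded_degree_def symmetric_series_def)

setup_lifting type_definition_symfun

instantiation symfun :: comm_ring_1
begin

lift_definition zero_symfun :: symfun is "\<lambda>_. 0"
  by (simp add: bounded_degree_def symmetric_series_def)

lift_definition one_symfun :: symfun is "\<lambda>m. if m = 0 then 1 else 0"
  by (auto simp: bounded_degree_def symmetric_series_def permute_vars_eq_0_iff)

lift_definition plus_symfun :: "symfun \<Rightarrow> symfun \<Rightarrow> symfun" is "\<lambda>f g m. f m + g m"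
  by (simp add: bounded_degree_add) (simp add: symmetric_series_def)

lift_definition uminus_symfun :: "symfun \<Rightarrow> symfun" is "\<lambda>f m. - f m"
  by (simp add: bounded_degree_def symmetric_series_def)

lift_definition minus_symfun :: "symfun \<Rightarrow> symfun \<Rightarrow> symfun" is "\<lambda>f g m. f m - g m"
  subgoal for f g
    using bounded_degree_add[of f "\<lambda>m. - g m"]
    by (simp add: bounded_degree_def symmetric_series_def)
  done

lift_definition times_symfun :: "symfun \<Rightarrow> symfun \<Rightarrow> symfun" is series_mult
  by (simp add: bounded_degree_mult symmetric_series_mult)

instance
proof
  fix a b c :: symfun
  show "a * b * c = a * (b * c)" by transfer (rule series_mult_assoc)
  show "a * b = b * a" by transfer (rule series_mult_commute)
  show "1 * a = a" by transfer (rule series_mult_one)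
  show "(a + b) * c = a * c + b * c" by transfer (rule ext, rule series_mult_distrib)
  show "(0::symfun) \<noteq> 1" by transfer (metis zero_neq_one)
qed (transfer; simp add: fun_eq_iff)+

end

subsection \<open>Elementary symmetric functions and plethysm by power sums\<close>

text \<open>
  \<open>elem_sym r\<close> is the sum of all products of \<open>r\<close> distinct variables. The index is an
  integer, and \<open>e\<^sub>r = 0\<close> for \<open>r < 0\<close>.
\<close>

lift_definition elem_sym :: "int \<Rightarrow> symfun" is
  "\<lambda>r m. if (\<forall>i. Poly_Mapping.lookup m i \<le> 1) \<and> int (card (Poly_Mapping.keys m)) = r then 1 else 0"
proof -
  fix r :: int
  let ?e = "\<lambda>m. if (\<forall>i. Poly_Mapping.lookup m i \<le> 1) \<and> int (card (Poly_Mapping.keys m)) = r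
    then 1 else (0::int)"
  have "monomial_degree m \<le> nat r" if "?e m \<noteq> 0" for m
  proof -
    have "monomial_degree m \<le> (\<Sum>i\<in>Poly_Mapping.keys m. 1)"
      unfolding monomial_degree_def using that by (intro sum_mono) (auto split: if_splits)
    then show ?thesis using that by (auto split: if_splits)
  qed
  moreover have "?e (permute_vars \<pi> m) = ?e m" if \<pi>: "bij \<pi>" for \<pi> m
  proof -
    have "card (Poly_Mapping.keys (permute_vars \<pi> m)) = card (Poly_Mapping.keys m)"
      by (rule bij_betw_same_card[OF bij_betw_keys_permute_vars[OF \<pi>]])
    moreover have "(\<forall>i. Poly_Mapping.lookup (permute_vars \<pi> m) i \<le> 1) \<longleftrightarrow>
        (\<forall>i. Poly_Mapping.lookup m i \<le> 1)"
      using \<pi> by (simp add: lookup_permute_vars) (metis bij_pointE)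
    ultimately show ?thesis by simp
  qed
  ultimately show "bounded_degree ?e \<and> symmetric_series ?e"
    unfolding bounded_degree_def symmetric_series_def by blast
qed

lemma elem_sym_0: "elem_sym 0 = 1"
  by transfer (auto simp: fun_eq_iff)

lemma elem_sym_neg: "r < 0 \<Longrightarrow> elem_sym r = 0"
  by transfer auto

text \<open>
  \<open>p\<^sub>n \<circ> f = f(x\<^sub>0\<^sup>n, x\<^sub>1\<^sup>n, \<dots>)\<close>: the substitution sends the monomial \<open>a\<close> to \<open>monomial_power n a\<close>,
  so the coefficient of \<open>m\<close> in the result is the sum of the coefficients in \<open>f\<close> of all \<open>a\<close>
  that are sent to \<open>m\<close> (at most one when \<open>n > 0\<close>; for \<open>n = 0\<close> the substitution is not
  defined, and this gives \<open>0\<close>).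
\<close>

definition monomial_power :: "nat \<Rightarrow> monomial \<Rightarrow> monomial" where
  "monomial_power n a = Poly_Mapping.map ((*) n) a"

lemma lookup_monomial_power:
  "Poly_Mapping.lookup (monomial_power n a) i = n * Poly_Mapping.lookup a i"
  by (simp add: monomial_power_def map.rep_eq when_def)

lemma monomial_power_permute_vars:
  "bij \<pi> \<Longrightarrow> monomial_power n (permute_vars \<pi> a) = permute_vars \<pi> (monomial_power n a)"
  by (rule monomial_eqI) (simp add: lookup_permute_vars lookup_monomial_power)

lemma inj_monomial_power: "n > 0 \<Longrightarrow> inj (monomial_power n)"
  by (rule injI, rule monomial_eqI) (metis lookup_monomial_power mult_left_cancel neq0_conv)

lemma monomial_degree_monomial_power:
  "monomial_degree (monomial_power n a) = n * monomial_degree a"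
proof -
  have "monomial_degree (monomial_power n a) =
      (\<Sum>i\<in>Poly_Mapping.keys a. Poly_Mapping.lookup (monomial_power n a) i)"
    unfolding monomial_degree_def
    by (rule sum.mono_neutral_left) (auto simp: in_keys_iff lookup_monomial_power)
  then show ?thesis
    by (simp add: lookup_monomial_power monomial_degree_def sum_distrib_left)
qed

lift_definition power_sum_plethysm :: "nat \<Rightarrow> symfun \<Rightarrow> symfun" is
  "\<lambda>n f m. \<Sum>a | monomial_power n a = m. f a"
proof -
  fix n and f :: "monomial \<Rightarrow> int"
  assume f: "bounded_degree f \<and> symmetric_series f"
  let ?g = "\<lambda>m. \<Sum>a | monomial_power n a = m. f a"
  from f obtain d where d: "\<And>m. f m \<noteq> 0 \<Longrightarrow> monomial_degree m \<le> d"
    unfolding bounded_degree_def by blast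
  have "monomial_degree m \<le> n * d" if nz: "?g m \<noteq> 0" for m
  proof -
    obtain a where "monomial_power n a = m" "f a \<noteq> 0"
      using nz by (auto elim: sum.not_neutral_contains_not_neutral)
    then show ?thesis
      using d by (auto simp: monomial_degree_monomial_power)
  qed
  moreover have "?g (permute_vars \<pi> m) = ?g m" if \<pi>: "bij \<pi>" for \<pi> m
    using \<pi> f bij_imp_bij_inv[OF \<pi>]
    by (intro sum.reindex_bij_witness[of _ "permute_vars \<pi>" "permute_vars (inv_into UNIV \<pi>)"])
      (auto simp: permute_vars_inv monomial_power_permute_vars symmetric_series_def)
  ultimately show "bounded_degree ?g \<and> symmetric_series ?g"
    unfolding bounded_degree_def symmetric_series_def by blast
qed

lemma coefficient_power_sum_plethysm:
  "n > 0 \<Longrightarrow> coefficient (power_sum_plethysm n f) (monomial_power n a) = coefficient f a"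
proof -
  assume "n > 0"
  then have "{b. monomial_power n b = monomial_power n a} = {a}"
    by (auto dest: injD[OF inj_monomial_power])
  then show ?thesis by (simp add: power_sum_plethysm.rep_eq)
qed

section \<open>Partitions and border strips\<close>

text \<open>
  A partition is the weakly decreasing list of its nonzero parts, so that \<open>\<ell>(\<lambda>) = length \<lambda>\<close>.
  Rows and columns are numbered from \<open>0\<close>; a box is a pair (row, column).
\<close>

definition is_partition :: "nat list \<Rightarrow> bool" where
  "is_partition l \<longleftrightarrow> sorted_wrt (\<ge>) l \<and> (\<forall>a\<in>set l. a > 0)"

definition is_partition_of :: "nat list \<Rightarrow> nat \<Rightarrow> bool" where
  "is_partition_of l N \<longleftrightarrow> is_partition l \<and> sum_list l = N"

lemma finite_partitions_of: "finite {l. is_partition_of l N}"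
proof (rule finite_subset)
  have len: "length l \<le> sum_list l" if "\<forall>a\<in>set l. a > 0" for l :: "nat list"
    using that by (induction l) auto
  show "{l. is_partition_of l N} \<subseteq> {l. set l \<subseteq> {..N} \<and> length l \<le> N}"
    using len by (auto simp: is_partition_of_def is_partition_def intro: member_le_sum_list)
qed (simp add: finite_lists_length_le)

type_synonym box = "nat \<times> nat"

definition diagram :: "nat list \<Rightarrow> box set" where
  "diagram l = {(i, j). i < length l \<and> j < l ! i}"

definition skew_diagram :: "nat list \<Rightarrow> nat list \<Rightarrow> box set" where
  "skew_diagram l \<mu> = diagram l - diagram \<mu>"

definition adjacent :: "box \<Rightarrow> box \<Rightarrow> bool" where
  "adjacent b c \<longleftrightarrow>
     (fst b = fst c \<and> (snd b = Suc (snd c) \<or> snd c = Suc (snd b))) \<or>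
     (snd b = snd c \<and> (fst b = Suc (fst c) \<or> fst c = Suc (fst b)))"

definition connected_boxes :: "box set \<Rightarrow> bool" where
  "connected_boxes D \<longleftrightarrow> (\<forall>b\<in>D. \<forall>c\<in>D. (b, c) \<in> {(x, y). x \<in> D \<and> y \<in> D \<and> adjacent x y}\<^sup>*)"

definition border_strip :: "nat \<Rightarrow> box set \<Rightarrow> bool" where
  "border_strip r D \<longleftrightarrow> finite D \<and> card D = r \<and> connected_boxes D \<and>
     \<not> (\<exists>i j. {(i, j), (i, Suc j), (Suc i, j), (Suc i, Suc j)} \<subseteq> D)"

definition starting_box :: "box set \<Rightarrow> box" where
  "starting_box D = (THE b. b \<in> D \<and> (\<forall>c\<in>D. fst b \<le> fst c \<and> snd c \<le> snd b))"

lemma starting_box_eqI: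
  assumes "b \<in> D" "\<And>c. c \<in> D \<Longrightarrow> fst b \<le> fst c \<and> snd c \<le> snd b"
  shows "starting_box D = b"
  unfolding starting_box_def
  by (rule the_equality) (use assms in \<open>auto intro!: prod_eqI antisym\<close>)

definition top_boxes :: "box set \<Rightarrow> box set" where
  "top_boxes D = {(i, j) \<in> D. \<forall>i'. (i', j) \<in> D \<longrightarrow> i \<le> i'}"

definition southwest :: "box \<Rightarrow> box \<Rightarrow> bool" where
  "southwest b c \<longleftrightarrow> fst c \<le> fst b \<and> snd b < snd c"

definition horizontal_border_strip :: "nat \<Rightarrow> nat \<Rightarrow> nat list \<Rightarrow> nat list \<Rightarrow> bool" where
  "horizontal_border_strip n k l \<mu> \<longleftrightarrow>
     (\<exists>\<alpha> :: nat \<Rightarrow> nat list. \<alpha> 0 = \<mu> \<and> \<alpha> k = l \<and>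
        (\<forall>i\<le>k. is_partition (\<alpha> i)) \<and>
        (\<forall>i\<in>{1..k}. diagram (\<alpha> (i - 1)) \<subseteq> diagram (\<alpha> i) \<and>
           border_strip n (skew_diagram (\<alpha> i) (\<alpha> (i - 1))) \<and>
           starting_box (skew_diagram (\<alpha> i) (\<alpha> (i - 1))) \<in> top_boxes (skew_diagram l \<mu>)) \<and>
        (\<forall>i\<in>{1..k}. \<forall>j\<in>{1..k}. i < j \<longrightarrow>
           southwest (starting_box (skew_diagram (\<alpha> i) (\<alpha> (i - 1))))
                     (starting_box (skew_diagram (\<alpha> j) (\<alpha> (j - 1))))))"

section \<open>The two matrices\<close>

text \<open>
  Matrix indices start at \<open>0\<close>; the formulas only involve the difference \<open>j - i\<close>, so they
  read the same as with indices starting at \<open>1\<close>.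
\<close>

definition M_matrix :: "nat \<Rightarrow> nat list \<Rightarrow> int mat" where
  "M_matrix n l = mat (length l) (length l) (\<lambda>(i, j).
     if int (l ! i) - int i \<ge> - int j \<and> int n dvd int (l ! i) - int i + int j then 1 else 0)"

definition elem_matrix :: "nat list \<Rightarrow> symfun mat" where
  "elem_matrix l = mat (length l) (length l) (\<lambda>(i, j). elem_sym (int (l ! i) + int j - int i))"

end

theory Submission
  imports Defs
begin

text \<open>
  The matrix \<open>M(\<lambda>)\<close> is the Jacobi--Trudi matrix of \<open>s\<^sub>\<lambda>\<close> at the \<open>n\<close>-th roots of unity, since
  \<open>1 / (1 - t\<^sup>n)\<close> is their generating function of complete symmetric polynomials. The formula is
  therefore the dual Cauchy identity at the roots of unity: on the product side,
  \<open>\<Prod>\<^sub>i \<Prod>\<^sub>j (1 + \<omega>\<^sup>j x\<^sub>i) = \<Prod>\<^sub>i (1 - (-x\<^sub>i)\<^sup>n)\<close>, whose part of degree \<open>n k\<close> is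
  \<open>(-1)\<^bsup>k(n-1)\<^esup> p\<^sub>n \<circ> e\<^sub>k\<close>.

  No roots of unity are needed. By Cauchy--Binet, the sum over \<open>\<lambda>\<close> of the products of the two
  determinants is the determinant of a circulant matrix, namely \<open>\<Prod>\<^sub>i (1 + x\<^sub>i P)\<close> with \<open>P\<close> the
  cyclic permutation matrix, and \<open>det (1 + x P) = 1 - (-x)\<^sup>n\<close>.

  If \<open>det M(\<lambda>) \<noteq> 0\<close>, the beads \<open>\<lambda>\<^sub>i + n - i\<close> are pairwise incongruent modulo \<open>n\<close> (otherwise
  two rows coincide). Then the largest bead can be moved down by \<open>n\<close>, which removes a border strip
  starting in the first row; iterating this shows that \<open>\<lambda>\<close> is a horizontal \<open>n\<close>-border strip.
\<close>

section \<open>Power series in infinitely many variables\<close>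

text \<open>The single variables are not symmetric, so the factorization of the generating function takes
  place in the ring of all power series, after the variables from \<open>x\<^sub>N\<close> on have been set to \<open>0\<close>.\<close>

typedef mseries = "UNIV :: (monomial \<Rightarrow> int) set"
  morphisms mcoeff Abs_mseries by simp

setup_lifting type_definition_mseries

instantiation mseries :: comm_ring_1
begin

lift_definition zero_mseries :: mseries is "\<lambda>_. 0" .
lift_definition one_mseries :: mseries is "\<lambda>m. if m = 0 then 1 else 0" .
lift_definition plus_mseries :: "mseries \<Rightarrow> mseries \<Rightarrow> mseries" is "\<lambda>f g m. f m + g m" .
lift_definition uminus_mseries :: "mseries \<Rightarrow> mseries" is "\<lambda>f m. - f m" .
lift_definition minus_mseries :: "mseries \<Rightarrow> mseries \<Rightarrow> mseries" is "\<lambda>f g m. f m - g m" .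
lift_definition times_mseries :: "mseries \<Rightarrow> mseries \<Rightarrow> mseries" is series_mult .

instance
proof
  fix a b c :: mseries
  show "a * b * c = a * (b * c)" by transfer (rule series_mult_assoc)
  show "a * b = b * a" by transfer (rule series_mult_commute)
  show "1 * a = a" by transfer (rule series_mult_one)
  show "(a + b) * c = a * c + b * c" by transfer (rule ext, rule series_mult_distrib)
  show "(0::mseries) \<noteq> 1" by transfer (metis zero_neq_one)
qed (transfer; simp add: fun_eq_iff)+

end

text \<open>This is evaluation at x_N = x_{N+1} = ... = 0. Nothing is lost overall: every monomial
  survives once \<open>N\<close> exceeds the indices of its variables.\<close>

lift_definition restrict_vars :: "nat \<Rightarrow> symfun \<Rightarrow> mseries" is
  "\<lambda>N f m. if Poly_Mapping.keys m \<subseteq> {..<N} then f m else 0" .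

lemma keys_add_monomial:
  "Poly_Mapping.keys (a + b :: monomial) = Poly_Mapping.keys a \<union> Poly_Mapping.keys b"
  by (auto simp: in_keys_iff lookup_add)

lemma mseries_eqI: "(\<And>m. mcoeff f m = mcoeff g m) \<Longrightarrow> f = g"
  by transfer auto

lemma mcoeff_restrict_vars:
  "mcoeff (restrict_vars N f) m = (if Poly_Mapping.keys m \<subseteq> {..<N} then coefficient f m else 0)"
  by transfer simp

text \<open>Exponents cannot cancel, so a product of monomials avoids the deleted variables exactly
  when both factors do.\<close>

interpretation restrict_vars: comm_ring_hom "restrict_vars N" for N
proof
  show "restrict_vars N (f * g) = restrict_vars N f * restrict_vars N g" for f g
  proof (rule mseries_eqI)
    fix m :: monomial
    have "mcoeff (restrict_vars N f * restrict_vars N g) m =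
        (\<Sum>(a, b) | a + b = m. if Poly_Mapping.keys m \<subseteq> {..<N}
          then coefficient f a * coefficient g b else 0)"
      unfolding times_mseries.rep_eq series_mult_def mcoeff_restrict_vars
      by (intro sum.cong refl) (auto simp: keys_add_monomial)
    also have "\<dots> = mcoeff (restrict_vars N (f * g)) m"
      by (simp add: mcoeff_restrict_vars times_symfun.rep_eq series_mult_def)
    finally show "mcoeff (restrict_vars N (f * g)) m = mcoeff (restrict_vars N f * restrict_vars N g) m"
      by simp
  qed
qed (transfer; auto simp: fun_eq_iff)+

section \<open>Monomials as power series\<close>

definition mseries_monomial :: "monomial \<Rightarrow> mseries" where
  "mseries_monomial a = Abs_mseries (\<lambda>m. if m = a then 1 else 0)"

lemma mcoeff_monomial: "mcoeff (mseries_monomial a) m = (if m = a then 1 else 0)"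
  by (simp add: mseries_monomial_def Abs_mseries_inverse)

text \<open>Monomials can be cancelled, so there is at most one complementary monomial
  \<open>b\<close>, and the definite description picks it.\<close>

lemma mcoeff_monomial_mult:
  "mcoeff (mseries_monomial a * f) m =
    (if \<exists>b. a + b = m then mcoeff f (THE b. a + b = m) else 0)"
proof -
  have "mcoeff (mseries_monomial a * f) m =
      (\<Sum>(c, b) | c + b = m \<and> c = a. mcoeff f b)"
    by (simp add: times_mseries.rep_eq series_mult_def mcoeff_monomial)
      (auto intro!: sum.mono_neutral_cong_right finite_splittings split: if_splits)
  also have "\<dots> = (if \<exists>b. a + b = m then mcoeff f (THE b. a + b = m) else 0)"
  proof (cases "\<exists>b. a + b = m")
    case True
    then obtain b where b: "a + b = m" by blast
    then have "{(c, d). c + d = m \<and> c = a} = {(a, b)}" by auto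
    moreover have "(THE b. a + b = m) = b" using b by auto
    ultimately show ?thesis using b by auto
  next
    case False
    then have empty: "{(c, d). c + d = m \<and> c = a} = {}" by auto
    show ?thesis using False unfolding empty by simp
  qed
  finally show ?thesis .
qed

lemma mseries_monomial_0: "mseries_monomial 0 = 1"
  by (rule mseries_eqI) (simp add: mcoeff_monomial one_mseries.rep_eq)

lemma mseries_monomial_mult:
  "mseries_monomial a * mseries_monomial b = mseries_monomial (a + b)"
  by (rule mseries_eqI) (auto simp: mcoeff_monomial_mult mcoeff_monomial)

lemma mseries_monomial_power:
  "mseries_monomial (Poly_Mapping.single i 1) ^ n = mseries_monomial (Poly_Mapping.single i n)"
  by (induction n) (simp_all add: mseries_monomial_0 mseries_monomial_mult flip: Poly_Mapping.single_add)

text \<open>\<open>elem_rec x N r\<close> is the elementary symmetric polynomial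
  \<open>e\<^sub>r(x\<^sub>0, \<dots>, x\<^bsub>N-1\<^esub>)\<close>.\<close>

fun elem_rec :: "(nat \<Rightarrow> 'a :: comm_ring_1) \<Rightarrow> nat \<Rightarrow> int \<Rightarrow> 'a" where
  "elem_rec x 0 r = (if r = 0 then 1 else 0)"
| "elem_rec x (Suc N) r = elem_rec x N r + x N * elem_rec x N (r - 1)"

text \<open>One induction serves two purposes: \<open>n = 1\<close> gives the elementary symmetric
  polynomials, general \<open>n\<close> their plethysms. Monomials divisible by x_N^n come from the
  second summand of the recursion, the others from the first.\<close>

lemma mcoeff_elem_rec:
  assumes "n > 0"
  shows "mcoeff (elem_rec (\<lambda>i. mseries_monomial (Poly_Mapping.single i n)) N r) m =
    (if Poly_Mapping.keys m \<subseteq> {..<N} \<and> (\<forall>i. Poly_Mapping.lookup m i \<in> {0, n}) \<and>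
        int (card (Poly_Mapping.keys m)) = r then 1 else 0)"
proof (induction N arbitrary: r m)
  case 0
  then show ?case by (auto simp: zero_mseries.rep_eq one_mseries.rep_eq)
next
  case (Suc N)
  let ?a = "Poly_Mapping.single N n :: monomial"
  show ?case
  proof (cases "\<exists>b. ?a + b = m")
    case True
    then obtain b where m: "m = ?a + b" by blast
    have the: "(THE c. ?a + c = m) = b" using m by auto
    have keys: "Poly_Mapping.keys m = insert N (Poly_Mapping.keys b)"
      using assms by (simp add: m keys_add_monomial)
    have lookup: "Poly_Mapping.lookup m i = (if i = N then n else 0) + Poly_Mapping.lookup b i" for i
      by (simp add: m lookup_add lookup_single when_def)
    show ?thesis
    proof (cases "N \<in> Poly_Mapping.keys b")
      \<comment> \<open>Here x_N occurs with an exponent above \<open>n\<close>, so both sides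
        vanish.\<close>
      case True
      then have "\<not> Poly_Mapping.keys b \<subseteq> {..<N}" by blast
      moreover have "Poly_Mapping.lookup m N \<noteq> 0 \<and> Poly_Mapping.lookup m N \<noteq> n"
        using True assms by (simp add: lookup in_keys_iff)
      then have "\<not> (\<forall>i. Poly_Mapping.lookup m i \<in> {0, n})" by auto
      moreover have "\<not> Poly_Mapping.keys m \<subseteq> {..<N}" by (simp add: keys)
      ultimately show ?thesis
        by (simp add: plus_mseries.rep_eq mcoeff_monomial_mult the Suc.IH)
    next
      case False
      then have "Poly_Mapping.lookup b N = 0" by (simp add: in_keys_iff)
      then have "(\<forall>i. Poly_Mapping.lookup m i \<in> {0, n}) \<longleftrightarrow> (\<forall>i. Poly_Mapping.lookup b i \<in> {0, n})"
        unfolding lookup by (metis add_0 add.right_neutral insertCI)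
      moreover have "Poly_Mapping.keys m \<subseteq> {..<Suc N} \<longleftrightarrow> Poly_Mapping.keys b \<subseteq> {..<N}"
        using False unfolding keys by (auto simp: less_Suc_eq)
      moreover have "card (Poly_Mapping.keys m) = Suc (card (Poly_Mapping.keys b))"
        using False by (simp add: keys)
      moreover have "\<not> Poly_Mapping.keys m \<subseteq> {..<N}" by (simp add: keys)
      moreover have "\<exists>b. ?a + b = m" using m by blast
      ultimately show ?thesis
        by (auto simp: plus_mseries.rep_eq mcoeff_monomial_mult the Suc.IH)
    qed
  next
    case False
    \<comment> \<open>Exponent \<open>n\<close> would make \<open>m\<close> divisible by x_N^n,
      which leaves only exponent 0.\<close>
    have "N \<notin> Poly_Mapping.keys m" if "Poly_Mapping.lookup m N \<in> {0, n}"
    proof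
      assume "N \<in> Poly_Mapping.keys m"
      with that have n: "Poly_Mapping.lookup m N = n" by (simp add: in_keys_iff)
      have "?a + (m - ?a) = m"
        by (rule monomial_eqI) (auto simp: lookup_add lookup_minus lookup_single when_def n)
      with False show False by blast
    qed
    then have "Poly_Mapping.keys m \<subseteq> {..<Suc N} \<longleftrightarrow> Poly_Mapping.keys m \<subseteq> {..<N}"
      if "\<forall>i. Poly_Mapping.lookup m i \<in> {0, n}"
      using that by (auto simp: less_Suc_eq)
    then show ?thesis
      using False by (auto simp: plus_mseries.rep_eq mcoeff_monomial_mult Suc.IH)
  qed
qed

lemma restrict_vars_elem_sym:
  "restrict_vars N (elem_sym r) = elem_rec (\<lambda>i. mseries_monomial (Poly_Mapping.single i 1)) N r"
  by (rule mseries_eqI)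
    (auto simp: mcoeff_restrict_vars mcoeff_elem_rec elem_sym.rep_eq le_Suc_eq)

lemma restrict_vars_plethysm:
  assumes n: "n > 0"
  shows "restrict_vars N (power_sum_plethysm n (elem_sym r)) =
    elem_rec (\<lambda>i. mseries_monomial (Poly_Mapping.single i 1) ^ n) N r"
proof (rule mseries_eqI)
  fix m
  have "coefficient (power_sum_plethysm n (elem_sym r)) m =
    (if (\<forall>i. Poly_Mapping.lookup m i \<in> {0, n}) \<and> int (card (Poly_Mapping.keys m)) = r then 1 else 0)"
  proof (cases "\<exists>a. monomial_power n a = m")
    case True
    then obtain a where m: "m = monomial_power n a" by blast
    have "Poly_Mapping.keys m = Poly_Mapping.keys a"
      using n by (auto simp: m in_keys_iff lookup_monomial_power)
    moreover have "(\<forall>i. Poly_Mapping.lookup m i \<in> {0, n}) \<longleftrightarrow> (\<forall>i. Poly_Mapping.lookup a i \<le> 1)"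
      using n by (auto simp: m lookup_monomial_power le_Suc_eq)
    ultimately show ?thesis
      using coefficient_power_sum_plethysm[OF n, of "elem_sym r" a] by (simp add: m elem_sym.rep_eq)
  next
    case False
    have "\<not> (\<forall>i. Poly_Mapping.lookup m i \<in> {0, n})"
    proof
      assume "\<forall>i. Poly_Mapping.lookup m i \<in> {0, n}"
      \<comment> \<open>Dividing all exponents by \<open>n\<close> gives a preimage; the division is
        exact because each exponent is 0 or \<open>n\<close>.\<close>
      then have "monomial_power n (Poly_Mapping.map (\<lambda>c. c div n) m) = m"
        using n by (intro monomial_eqI, simp add: lookup_monomial_power map.rep_eq when_def)
          (metis div_self div_0 mult_0_right mult_1_right neq0_conv)
      with False show False by blast
    qed
    moreover have "{a. monomial_power n a = m} = {}" using False by auto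
    ultimately show ?thesis by (auto simp: power_sum_plethysm.rep_eq)
  qed
  then show "mcoeff (restrict_vars N (power_sum_plethysm n (elem_sym r))) m =
      mcoeff (elem_rec (\<lambda>i. mseries_monomial (Poly_Mapping.single i 1) ^ n) N r) m"
    unfolding mseries_monomial_power mcoeff_elem_rec[OF n] mcoeff_restrict_vars by simp
qed

section \<open>The circulant determinant\<close>

lemma elem_rec_neg: "r < 0 \<Longrightarrow> elem_rec x N r = 0"
  by (induction N arbitrary: r) auto

lemma elem_rec_large: "r > int N \<Longrightarrow> elem_rec x N r = 0"
  by (induction N arbitrary: r) auto

text \<open>The bound on \<open>K\<close> puts all nonzero e_r into the range of summation, so the
  truncated sum is the full generating polynomial.\<close>

lemma elem_rec_generating:
  "N < K \<Longrightarrow> (\<Sum>r<K. s ^ r * elem_rec x N (int r)) = (\<Prod>i<N. 1 + s * x i)"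
proof (induction N)
  case 0
  have "(\<Sum>r<K. s ^ r * elem_rec x 0 (int r)) = (\<Sum>r<K. if r = 0 then 1 else 0)"
    by (rule sum.cong) auto
  then show ?case using 0 by simp
next
  case (Suc N)
  \<comment> \<open>Preparation of an index shift: the term \<open>r = 0\<close> has a negative
    index, and extending the shifted sum to \<open>r = K'\<close> adds zero because N < K'.\<close>
  obtain K' where K: "K = Suc K'" using Suc.prems by (cases K) auto
  have "(\<Sum>r<K. s ^ r * elem_rec x N (int r - 1)) = s * (\<Sum>r<K'. s ^ r * elem_rec x N (int r))"
    unfolding K by (subst sum.lessThan_Suc_shift) (simp add: elem_rec_neg sum_distrib_left mult.assoc)
  also have "(\<Sum>r<K'. s ^ r * elem_rec x N (int r)) = (\<Sum>r<K. s ^ r * elem_rec x N (int r))"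
    using Suc.prems unfolding K by (simp add: elem_rec_large)
  also have "\<dots> = (\<Prod>i<N. 1 + s * x i)" using Suc by simp
  finally have "(\<Sum>r<K. s ^ r * elem_rec x N (int r - 1)) = s * (\<Prod>i<N. 1 + s * x i)" .
  then have "(\<Sum>r<K. s ^ r * elem_rec x (Suc N) (int r)) =
      (\<Prod>i<N. 1 + s * x i) + x N * (s * (\<Prod>i<N. 1 + s * x i))"
    using Suc by (simp add: distrib_left sum.distrib sum_distrib_left[symmetric] mult.left_commute)
  then show ?case by (simp add: algebra_simps)
qed

text \<open>\<open>cyclic_shift n x\<close> is \<open>1 + x P\<close> with \<open>P\<close> the permutation matrix of the cycle
  \<open>i \<mapsto> i + 1\<close> modulo \<open>n\<close>.\<close>

definition cyclic_shift :: "nat \<Rightarrow> 'a :: comm_ring_1 \<Rightarrow> 'a mat" where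
  "cyclic_shift n x = mat n n (\<lambda>(i, j).
     (if i = j then 1 else 0) + (if j = (if Suc i = n then 0 else Suc i) then x else 0))"

text \<open>Expansion along the first column, where only the first and the last row contribute.
  Their minors are triangular, with diagonal entries 1 and \<open>x\<close> respectively.\<close>

lemma det_cyclic_shift:
  fixes x :: "'a :: comm_ring_1"
  assumes n: "n > 0"
  shows "det (cyclic_shift n x) = 1 + (- 1) ^ (n - 1) * x ^ n"
proof (cases "n = 1")
  \<comment> \<open>For \<open>n = 1\<close> the diagonal entry and the cyclic entry share one
    position and add up.\<close>
  case True
  have "det (cyclic_shift n x) = cyclic_shift n x $$ (0, 0)"
    by (rule det_single) (simp add: True cyclic_shift_def)
  then show ?thesis by (simp add: True cyclic_shift_def)
next
  case False
  with n obtain l where l: "n = Suc l" "l > 0" by (cases n) auto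
  let ?A = "cyclic_shift n x"
  have A: "?A \<in> carrier_mat n n" by (simp add: cyclic_shift_def)
  have "mat_delete ?A 0 0 \<in> carrier_mat l l" "upper_triangular (mat_delete ?A 0 0)"
    by (auto simp: l mat_delete_def cyclic_shift_def upper_triangular_def)
  moreover have "diag_mat (mat_delete ?A 0 0) = replicate l 1"
    by (auto simp: l mat_delete_def cyclic_shift_def diag_mat_def intro!: nth_equalityI)
  ultimately have c0: "cofactor ?A 0 0 = 1"
    by (simp add: cofactor_def det_upper_triangular)
  have "mat_delete ?A l 0 \<in> carrier_mat l l"
    "\<And>i j. i < j \<Longrightarrow> j < l \<Longrightarrow> mat_delete ?A l 0 $$ (i, j) = 0"
    by (auto simp: l mat_delete_def cyclic_shift_def)
  moreover have "diag_mat (mat_delete ?A l 0) = replicate l x"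
    by (auto simp: l mat_delete_def cyclic_shift_def diag_mat_def intro!: nth_equalityI)
  ultimately have "det (mat_delete ?A l 0) = x ^ l"
    by (metis det_lower_triangular prod_list_replicate)
  then have cl: "cofactor ?A l 0 = (- 1) ^ l * x ^ l"
    by (simp add: cofactor_def)
  have "det ?A = (\<Sum>i<n. ?A $$ (i, 0) * cofactor ?A i 0)"
    by (rule laplace_expansion_column[OF A n])
  also have "\<dots> = (\<Sum>i\<in>{0, l}. ?A $$ (i, 0) * cofactor ?A i 0)"
    by (rule sum.mono_neutral_right) (auto simp: l cyclic_shift_def)
  also have "\<dots> = 1 + x * ((- 1) ^ l * x ^ l)"
  proof -
    have "?A $$ (0, 0) = 1" "?A $$ (l, 0) = x"
      using l by (auto simp: cyclic_shift_def)
    then show ?thesis using l(2) c0 cl by simp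
  qed
  finally show ?thesis by (simp add: l)
qed

text \<open>With \<open>K > N\<close> the sum is the complete sum of the \<open>e\<^sub>r\<close> over all \<open>r \<equiv> j - i\<close> modulo \<open>n\<close>, so
  that the matrix is \<open>E(P)\<close> for the generating polynomial \<open>E\<close> of the \<open>e\<^sub>r\<close>.\<close>

definition residue_matrix :: "nat \<Rightarrow> (nat \<Rightarrow> 'a :: comm_ring_1) \<Rightarrow> nat \<Rightarrow> nat \<Rightarrow> 'a mat" where
  "residue_matrix n x K N =
     mat n n (\<lambda>(i, j). \<Sum>q<K. elem_rec x N (int (q * n) + int j - int i))"

text \<open>Read as E(P), the matrix acquires the factor 1 + x_N P from the new variable. In entries
  this is the recursion of \<open>elem_rec\<close>, where the index r - 1 leads to the cyclically
  preceding column.\<close>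

lemma residue_matrix_Suc:
  assumes n: "n > 0" and K: "Suc N < K"
  shows "residue_matrix n x K (Suc N) = residue_matrix n x K N * cyclic_shift n (x N)"
proof (rule eq_matI)
  let ?C = "residue_matrix n x K N" and ?P = "cyclic_shift n (x N)"
  fix i j assume "i < dim_row (?C * ?P)" "j < dim_col (?C * ?P)"
  then have ij: "i < n" "j < n" by (simp_all add: residue_matrix_def cyclic_shift_def)
  define j' where "j' = (if j = 0 then n - 1 else j - 1)"
  have j': "j' < n" using ij by (auto simp: j'_def)
  have succ: "j = (if Suc k = n then 0 else Suc k) \<longleftrightarrow> k = j'" if "k < n" for k
    using that ij by (auto simp: j'_def)
  have "(\<Sum>q<K. elem_rec x N (int (q * n) + int j - int i - 1)) =
      (\<Sum>q<K. elem_rec x N (int (q * n) + int j' - int i))"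
  proof (cases "j = 0")
    \<comment> \<open>From column 0 the step back wraps around to column n - 1 and shifts
      \<open>q\<close> by one. The unmatched end terms vanish: one has a negative index, the other
      an index above \<open>N\<close>.\<close>
    case True
    obtain K' where K': "K = Suc K'" using K by (cases K) auto
    have le: "int K' \<le> int K' * int n" using n by (simp add: mult_le_cancel_left1)
    have "int K' * int n + int j' - int i > int N"
      using ij K K' by (simp add: True j'_def of_nat_diff n Suc_leI ) (use le in linarith)
    then show ?thesis
      using True ij unfolding K'
      by (subst sum.lessThan_Suc_shift) (simp add: elem_rec_neg elem_rec_large j'_def of_nat_diff algebra_simps)
  next
    case False
    then show ?thesis by (simp add: j'_def of_nat_diff algebra_simps)
  qed
  then have "residue_matrix n x K (Suc N) $$ (i, j) = ?C $$ (i, j) + x N * ?C $$ (i, j')"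
    using ij j' by (simp add: residue_matrix_def sum.distrib flip: sum_distrib_left)
  also have "\<dots> = (\<Sum>k\<in>{0..<n}. (if k = j then ?C $$ (i, k) else 0)) +
      (\<Sum>k\<in>{0..<n}. (if k = j' then x N * ?C $$ (i, k) else 0))"
    using ij j' by simp
  also have "\<dots> = (\<Sum>k\<in>{0..<n}. ?C $$ (i, k) * ?P $$ (k, j))"
    unfolding sum.distrib[symmetric] using ij
    by (intro sum.cong) (simp_all add: cyclic_shift_def succ algebra_simps)
  also have "\<dots> = (?C * ?P) $$ (i, j)"
    using ij by (simp add: scalar_prod_def residue_matrix_def cyclic_shift_def)
  finally show "residue_matrix n x K (Suc N) $$ (i, j) = (?C * ?P) $$ (i, j)" .
qed (simp_all add: residue_matrix_def cyclic_shift_def)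

lemma det_residue_matrix:
  fixes x :: "nat \<Rightarrow> 'a :: comm_ring_1"
  assumes n: "n > 0" and "N < K"
  shows "det (residue_matrix n x K N) = (\<Prod>i<N. 1 + (- 1) ^ (n - 1) * x i ^ n)"
  using \<open>N < K\<close>
proof (induction N)
  case 0
  have "residue_matrix n x K 0 = 1\<^sub>m n"
  proof (rule eq_matI)
    fix i j assume "i < dim_row (1\<^sub>m n)" "j < dim_col (1\<^sub>m n)"
    then have ij: "i < n" "j < n" by simp_all
    \<comment> \<open>Without variables only e_0 is nonzero, and index 0 occurs just for
      \<open>q = 0\<close> on the diagonal.\<close>
    have "int (q * n) + int j - int i = 0 \<longleftrightarrow> q = 0 \<and> i = j" for q
    proof (cases q)
      case (Suc q')
      then have "int (q * n) + int j - int i > 0" using ij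
        by (simp add: algebra_simps) (use mult_nonneg_nonneg[of "int n" "int q'"] in linarith)
      then show ?thesis using Suc by simp
    qed auto
    then have "(\<Sum>q<K. elem_rec x 0 (int (q * n) + int j - int i)) =
        (\<Sum>q<K. if q = 0 then (if i = j then 1 else 0) else 0)"
      by (intro sum.cong) auto
    then show "residue_matrix n x K 0 $$ (i, j) = 1\<^sub>m n $$ (i, j)"
      using ij 0 by (simp add: residue_matrix_def)
  qed (simp_all add: residue_matrix_def)
  then show ?case by simp
next
  case (Suc N)
  have "det (residue_matrix n x K (Suc N)) = det (residue_matrix n x K N) * det (cyclic_shift n (x N))"
    unfolding residue_matrix_Suc[OF n Suc.prems]
    by (rule det_mult[of _ n]) (simp_all add: residue_matrix_def cyclic_shift_def)
  with Suc show ?case by (simp add: det_cyclic_shift[OF n])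
qed

section \<open>The Cauchy--Binet formula\<close>

text \<open>In Cauchy--Binet this turns functions with image \<open>S\<close> into permutations. A
  surjection between finite sets of equal size is bijective, so following it by the inverse of
  \<open>g\<close> gives the permutation; \<open>restrict\<close> fits the extensional function
  space.\<close>

lemma bij_betw_permutes_enumerations:
  fixes n :: nat
  assumes g: "bij_betw g {0..<n} S"
  shows "bij_betw (\<lambda>p. restrict (g \<circ> p) {0..<n}) {p. p permutes {0..<n}}
    {f \<in> {0..<n} \<rightarrow>\<^sub>E S. f ` {0..<n} = S}"
proof (rule bij_betwI')
  fix p q assume p: "p \<in> {p. p permutes {0..<n}}" and q: "q \<in> {p. p permutes {0..<n}}"
  show "restrict (g \<circ> p) {0..<n} = restrict (g \<circ> q) {0..<n} \<longleftrightarrow> p = q"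
  proof
    assume eq: "restrict (g \<circ> p) {0..<n} = restrict (g \<circ> q) {0..<n}"
    show "p = q"
    proof
      fix i
      show "p i = q i"
      proof (cases "i \<in> {0..<n}")
        case True
        then have "g (p i) = g (q i)" using fun_cong[OF eq, of i] by simp
        moreover have "p i \<in> {0..<n}" "q i \<in> {0..<n}"
          using p q True by (simp_all only: mem_Collect_eq permutes_in_image)
        ultimately show ?thesis
          using bij_betw_imp_inj_on[OF g] by (meson inj_onD)
      next
        case False
        then show ?thesis using p q by (simp add: permutes_not_in del: atLeastLessThan_iff)
      qed
    qed
  qed simp
next
  fix p assume p: "p \<in> {p. p permutes {0..<n}}"
  have "(g \<circ> p) ` {0..<n} = S"
    using p bij_betw_imp_surj_on[OF g] by (simp only: image_comp[symmetric] mem_Collect_eq permutes_image)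
  then show "restrict (g \<circ> p) {0..<n} \<in> {f \<in> {0..<n} \<rightarrow>\<^sub>E S. f ` {0..<n} = S}"
    by auto
next
  fix f assume f: "f \<in> {f \<in> {0..<n} \<rightarrow>\<^sub>E S. f ` {0..<n} = S}"
  have "card S = n" "finite S" using bij_betw_same_card[OF g] bij_betw_finite[OF g] by simp_all
  then have "inj_on f {0..<n}" using f by (intro eq_card_imp_inj_on) auto
  then have bf: "bij_betw f {0..<n} S" using f by (simp add: bij_betw_def)
  define p where "p i = (if i \<in> {0..<n} then inv_into {0..<n} g (f i) else i)" for i
  have "bij_betw (inv_into {0..<n} g \<circ> f) {0..<n} {0..<n}"
    using bij_betw_trans[OF bf bij_betw_inv_into[OF g]] .
  then have "bij_betw p {0..<n} {0..<n}"
    by (rule bij_betw_cong[THEN iffD1, rotated]) (simp add: p_def)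
  then have "p permutes {0..<n}"
    by (rule bij_imp_permutes) (simp only: p_def if_False)
  moreover have "f = restrict (g \<circ> p) {0..<n}"
    using f by (intro ext) (auto simp: p_def PiE_def extensional_def f_inv_into_f
        bij_betw_imp_surj_on[OF g])
  ultimately show "\<exists>p\<in>{p. p permutes {0..<n}}. f = restrict (g \<circ> p) {0..<n}" by blast
qed

text \<open>Multilinearity expands the determinant over all functions \<open>f\<close> from row
  indices to \<open>T\<close>. A repeated value gives two equal rows; the remaining \<open>f\<close>
  are grouped by their image \<open>S\<close>, for which they are permutations of
  \<open>g S\<close>.\<close>

theorem cauchy_binet:
  fixes A B :: "'b \<Rightarrow> nat \<Rightarrow> 'a :: comm_ring_1"
  assumes T: "finite T" and g: "\<And>S. S \<subseteq> T \<Longrightarrow> card S = n \<Longrightarrow> bij_betw (g S) {0..<n} S"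
  shows "det (mat n n (\<lambda>(i, j). \<Sum>t\<in>T. A t i * B t j)) =
    (\<Sum>S | S \<subseteq> T \<and> card S = n.
       det (mat n n (\<lambda>(i, j). A (g S i) j)) * det (mat n n (\<lambda>(i, j). B (g S i) j)))"
proof -
  let ?I = "{0..<n}" and ?P = "{p. p permutes {0..<n}}"
  let ?D = "\<lambda>f. det (mat n n (\<lambda>(i, j). B (f i) j))"
  let ?F = "\<lambda>f. (\<Prod>i\<in>?I. A (f i) i) * ?D f"
  have fin: "finite (?I \<rightarrow>\<^sub>E T)" using T by (simp add: finite_PiE)
  have D: "?D f = (\<Sum>p\<in>?P. signof p * (\<Prod>i\<in>?I. B (f i) (p i)))" for f
    by (subst det_def') (auto intro!: sum.cong prod.cong)
  have "det (mat n n (\<lambda>(i, j). \<Sum>t\<in>T. A t i * B t j)) =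
      (\<Sum>p\<in>?P. signof p * (\<Prod>i\<in>?I. \<Sum>t\<in>T. A t i * B t (p i)))"
    by (subst det_def') (auto intro!: sum.cong prod.cong)
  also have "\<dots> = (\<Sum>p\<in>?P. \<Sum>f\<in>?I \<rightarrow>\<^sub>E T. signof p * (\<Prod>i\<in>?I. A (f i) i * B (f i) (p i)))"
    by (subst prod_sum_PiE) (auto simp: T sum_distrib_left)
  also have "\<dots> = (\<Sum>f\<in>?I \<rightarrow>\<^sub>E T. \<Sum>p\<in>?P. signof p * (\<Prod>i\<in>?I. A (f i) i * B (f i) (p i)))"
    by (rule sum.swap)
  also have "\<dots> = (\<Sum>f\<in>?I \<rightarrow>\<^sub>E T. ?F f)"
    unfolding D by (simp add: prod.distrib sum_distrib_left mult.left_commute)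
  also have "\<dots> = (\<Sum>f\<in>{f \<in> ?I \<rightarrow>\<^sub>E T. card (f ` ?I) = n}. ?F f)"
  proof (rule sum.mono_neutral_right[OF fin])
    show "\<forall>f\<in>(?I \<rightarrow>\<^sub>E T) - {f \<in> ?I \<rightarrow>\<^sub>E T. card (f ` ?I) = n}. ?F f = 0"
    proof
      fix f assume "f \<in> (?I \<rightarrow>\<^sub>E T) - {f \<in> ?I \<rightarrow>\<^sub>E T. card (f ` ?I) = n}"
      then have "\<not> inj_on f ?I" using card_image[of f ?I] by auto
      then obtain i j where ij: "i < n" "j < n" "i \<noteq> j" "f i = f j" by (auto simp: inj_on_def)
      have "?D f = 0"
        by (rule det_identical_rows[of _ n i j]) (use ij in auto)
      then show "?F f = 0" by simp
    qed
  qed auto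
  also have "\<dots> = (\<Sum>S | S \<subseteq> T \<and> card S = n. \<Sum>f\<in>{f \<in> {f \<in> ?I \<rightarrow>\<^sub>E T. card (f ` ?I) = n}. f ` ?I = S}. ?F f)"
    by (rule sum.group[symmetric]) (use T fin in auto)
  also have "\<dots> = (\<Sum>S | S \<subseteq> T \<and> card S = n.
      det (mat n n (\<lambda>(i, j). A (g S i) j)) * det (mat n n (\<lambda>(i, j). B (g S i) j)))"
  proof (rule sum.cong[OF refl])
    fix S assume "S \<in> {S. S \<subseteq> T \<and> card S = n}"
    then have S: "S \<subseteq> T" "card S = n" by auto
    have "{f \<in> {f \<in> ?I \<rightarrow>\<^sub>E T. card (f ` ?I) = n}. f ` ?I = S} = {f \<in> ?I \<rightarrow>\<^sub>E S. f ` ?I = S}"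
      using S by (auto simp: PiE_def Pi_def)
    then have "(\<Sum>f\<in>{f \<in> {f \<in> ?I \<rightarrow>\<^sub>E T. card (f ` ?I) = n}. f ` ?I = S}. ?F f) =
        (\<Sum>p\<in>?P. ?F (restrict (g S \<circ> p) ?I))"
      using sum.reindex_bij_betw[OF bij_betw_permutes_enumerations[OF g[OF S]], of ?F] by simp
    also have "\<dots> = (\<Sum>p\<in>?P. (signof p * (\<Prod>i\<in>?I. A (g S (p i)) i)) * ?D (g S))"
    proof (rule sum.cong[OF refl])
      fix p assume "p \<in> ?P"
      then have p: "p permutes ?I" by simp
      have lt: "p i < n" if "i < n" for i using permutes_in_image[OF p, of i] that by simp
      have "?D (restrict (g S \<circ> p) ?I) =
          det (mat n n (\<lambda>(i, j). mat n n (\<lambda>(i, j). B (g S i) j) $$ (p i, j)))"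
        by (intro arg_cong[of _ _ det] eq_matI) (auto simp: lt)
      \<comment> \<open>The sign of the row permutation completes the products of entries of
        \<open>A\<close> to a Leibniz expansion.\<close>
      also have "\<dots> = signof p * ?D (g S)"
        by (rule det_permute_rows[OF _ p]) simp
      finally show "?F (restrict (g S \<circ> p) ?I) = (signof p * (\<Prod>i\<in>?I. A (g S (p i)) i)) * ?D (g S)"
        by simp
    qed
    also have "\<dots> = (\<Sum>p\<in>?P. signof p * (\<Prod>i\<in>?I. A (g S (p i)) i)) * ?D (g S)"
      by (simp add: sum_distrib_right)
    also have "(\<Sum>p\<in>?P. signof p * (\<Prod>i\<in>?I. A (g S (p i)) i)) = det (mat n n (\<lambda>(i, j). A (g S j) i))"
      by (subst det_def'[of _ n]) (auto intro!: sum.cong prod.cong dest: permutes_in_image)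
    also have "\<dots> = det (transpose_mat (mat n n (\<lambda>(i, j). A (g S j) i)))"
      by (rule det_transpose[symmetric, of _ n]) simp
    also have "transpose_mat (mat n n (\<lambda>(i, j). A (g S j) i)) = mat n n (\<lambda>(i, j). A (g S i) j)"
      by (intro eq_matI) auto
    finally show "(\<Sum>f\<in>{f \<in> {f \<in> ?I \<rightarrow>\<^sub>E T. card (f ` ?I) = n}. f ` ?I = S}. ?F f) =
        det (mat n n (\<lambda>(i, j). A (g S i) j)) * ?D (g S)" .
  qed
  finally show ?thesis .
qed

section \<open>Partitions and beads\<close>

definition part :: "nat list \<Rightarrow> nat \<Rightarrow> nat" where
  "part l i = (if i < length l then l ! i else 0)"

text \<open>These are the beta-numbers of \<open>l\<close> with respect to \<open>n\<close> rows:
  adding the staircase turns weak into strict decrease.\<close>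

definition bead :: "nat \<Rightarrow> nat list \<Rightarrow> nat \<Rightarrow> nat" where
  "bead n l i = part l i + (n - 1 - i)"

lemma part_pos_iff: "is_partition l \<Longrightarrow> part l i > 0 \<longleftrightarrow> i < length l"
  by (auto simp: part_def is_partition_def)

lemma part_antimono:
  assumes "is_partition l" "i \<le> j"
  shows "part l j \<le> part l i"
proof (cases "i < j \<and> j < length l")
  case True
  then show ?thesis
    using assms by (simp add: is_partition_def part_def sorted_wrt_iff_nth_less)
next
  case False
  then consider "i = j" | "j \<ge> length l" using assms(2) by linarith
  then show ?thesis by cases (simp_all add: part_def)
qed

lemma partition_eqI:
  assumes "is_partition l" "is_partition l'" "\<And>i. part l i = part l' i"
  shows "l = l'"
proof (rule nth_equalityI)
  have "i < length l \<longleftrightarrow> i < length l'" for i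
    using part_pos_iff[OF assms(1), of i] part_pos_iff[OF assms(2), of i] assms(3)[of i] by simp
  then show len: "length l = length l'" by (meson linorder_neqE_nat less_irrefl_nat)
  show "l ! i = l' ! i" if "i < length l" for i
    using assms(3)[of i] that len by (simp add: part_def)
qed

text \<open>Lists carry nonzero parts only, so the list is cut at the least zero of
  \<open>f\<close>; monotonicity makes \<open>f\<close> vanish from there on.\<close>

lemma partition_of_fun:
  assumes anti: "\<And>i. f (Suc i) \<le> f i" and zero: "f n = 0"
  shows "\<exists>l. is_partition l \<and> length l \<le> n \<and> part l = f"
proof (intro exI conjI)
  define k where "k = (LEAST k. f k = 0)"
  let ?l = "map f [0..<k]"
  have mono: "f j \<le> f i" if "i \<le> j" for i j
    using lift_Suc_antimono_le[of f, OF anti that] .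
  have k: "f k = 0" unfolding k_def by (rule LeastI[of _ n]) (rule zero)
  have pos: "f i > 0" if "i < k" for i using not_less_Least[of i "\<lambda>k. f k = 0"] that unfolding k_def by simp
  show "is_partition ?l"
    by (auto simp: is_partition_def sorted_wrt_iff_nth_less pos mono)
  show "length ?l \<le> n" using zero by (simp add: k_def Least_le)
  have "f i = 0" if "k \<le> i" for i using mono[OF that] k by simp
  then show "part ?l = f" by (simp add: part_def fun_eq_iff)
qed

lemma sum_list_part: "length l \<le> n \<Longrightarrow> sum_list l = (\<Sum>i<n. part l i)"
proof -
  assume l: "length l \<le> n"
  have "sum_list l = (\<Sum>i<length l. part l i)"
    by (simp add: sum_list_sum_nth part_def atLeast0LessThan)
  also have "\<dots> = (\<Sum>i<n. part l i)"
    by (rule sum.mono_neutral_left) (use l in \<open>auto simp: part_def\<close>)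
  finally show ?thesis .
qed

lemma bead_less: "is_partition l \<Longrightarrow> i < j \<Longrightarrow> j < n \<Longrightarrow> bead n l j < bead n l i"
  using part_antimono[of l i j] by (simp add: bead_def)

lemma inj_on_bead: "is_partition l \<Longrightarrow> inj_on (bead n l) {0..<n}"
  by (intro inj_onI) (metis bead_less atLeastLessThan_iff less_irrefl_nat nat_neq_iff)

section \<open>Partitions as finite sets of beads\<close>

definition bounded_partitions :: "nat \<Rightarrow> nat \<Rightarrow> nat list set" where
  "bounded_partitions n K = {l. is_partition l \<and> length l \<le> n \<and> (\<forall>i<n. bead n l i < K)}"

text \<open>Both reversed lists of values are the increasing enumeration of the common
  image.\<close>

lemma strict_decreasing_unique:
  fixes f g :: "nat \<Rightarrow> nat"
  assumes f: "\<And>i j. i < j \<Longrightarrow> j < n \<Longrightarrow> f j < f i"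
    and g: "\<And>i j. i < j \<Longrightarrow> j < n \<Longrightarrow> g j < g i"
    and eq: "f ` {0..<n} = g ` {0..<n}" and i: "i < n"
  shows "f i = g i"
proof -
  have sorted: "sorted_wrt (<) (rev (map h [0..<n]))"
    if "\<And>i j. i < j \<Longrightarrow> j < n \<Longrightarrow> h j < h i" for h :: "nat \<Rightarrow> nat"
    using that by (auto simp: sorted_wrt_iff_nth_less rev_nth)
  have "rev (map f [0..<n]) = rev (map g [0..<n])"
    by (rule strict_sorted_equal) (use sorted[of f, OF f] sorted[of g, OF g] eq in simp_all)
  then show ?thesis using i by simp
qed

text \<open>The inverse sorts \<open>S\<close> decreasingly and subtracts the staircase.\<close>

lemma bij_betw_bead_set:
  "bij_betw (\<lambda>l. bead n l ` {0..<n}) (bounded_partitions n K) {S. S \<subseteq> {..<K} \<and> card S = n}"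
proof (rule bij_betw_imageI)
  show "inj_on (\<lambda>l. bead n l ` {0..<n}) (bounded_partitions n K)"
  proof (rule inj_onI)
    fix l m assume l: "l \<in> bounded_partitions n K" and m: "m \<in> bounded_partitions n K"
      and eq: "bead n l ` {0..<n} = bead n m ` {0..<n}"
    have "part l i = part m i" for i
    proof (cases "i < n")
      case True
      have "bead n l i = bead n m i"
        by (rule strict_decreasing_unique[OF _ _ eq True])
          (use l m in \<open>simp_all add: bounded_partitions_def bead_less\<close>)
      then show ?thesis by (simp add: bead_def)
    next
      case False
      then show ?thesis using l m by (simp add: bounded_partitions_def part_def)
    qed
    then show "l = m" using l m by (intro partition_eqI) (simp_all add: bounded_partitions_def)
  qed
  show "(\<lambda>l. bead n l ` {0..<n}) ` bounded_partitions n K = {S. S \<subseteq> {..<K} \<and> card S = n}"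
  proof (intro equalityI subsetI)
    fix S assume "S \<in> {S. S \<subseteq> {..<K} \<and> card S = n}"
    then have S: "S \<subseteq> {..<K}" "card S = n" by auto
    then have fin: "finite S" using finite_subset by blast
    define b where "b i = rev (sorted_list_of_set S) ! i" for i
    have b_less: "b j < b i" if "i < j" "j < n" for i j
    proof -
      have "sorted_wrt (>) (rev (sorted_list_of_set S))"
        by (simp add: sorted_wrt_rev)
      then show ?thesis using that S by (simp add: sorted_wrt_iff_nth_less b_def)
    qed
    have b_image: "b ` {0..<n} = S"
    proof -
      have "b ` {0..<n} = set (map b [0..<n])" by simp
      also have "map b [0..<n] = rev (sorted_list_of_set S)"
        using S by (intro nth_equalityI) (simp_all add: b_def)
      finally show ?thesis using fin by simp
    qed
    \<comment> \<open>Strict descent by \<open>d\<close> places costs at least \<open>d\<close>;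
      with d = n - 1 - i this makes the truncated subtraction in \<open>f\<close> exact.\<close>
    have step: "b (i + d) + d \<le> b i" if "i + d < n" for i d
      using that
    proof (induction d)
      case (Suc d)
      then show ?case using b_less[of "i + d" "i + Suc d"] by simp
    qed simp
    have ge: "n - 1 - i \<le> b i" if "i < n" for i
      using step[of i "n - 1 - i"] that by simp
    define f where "f i = (if i < n then b i - (n - 1 - i) else 0)" for i
    have anti: "f (Suc i) \<le> f i" for i
      using b_less[of i "Suc i"] by (cases "Suc i < n") (auto simp: f_def)
    have "f n = 0" by (simp add: f_def)
    with anti obtain l where l: "is_partition l" "length l \<le> n" "part l = f"
      using partition_of_fun[of f n] by blast
    have bead: "bead n l i = b i" if "i < n" for i
      using ge[OF that] that by (simp add: bead_def l f_def)
    have "bead n l ` {0..<n} = b ` {0..<n}" by (rule image_cong) (simp_all add: bead)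
    then have "bead n l ` {0..<n} = S" using b_image by simp
    moreover have "bead n l i < K" if "i < n" for i
    proof -
      have "b i \<in> S" using b_image that by fastforce
      then show ?thesis using S bead[OF that] by auto
    qed
    then have "l \<in> bounded_partitions n K"
      using l by (simp add: bounded_partitions_def)
    ultimately show "S \<in> (\<lambda>l. bead n l ` {0..<n}) ` bounded_partitions n K" by blast
  next
    fix S assume "S \<in> (\<lambda>l. bead n l ` {0..<n}) ` bounded_partitions n K"
    then show "S \<in> {S. S \<subseteq> {..<K} \<and> card S = n}"
      by (auto simp: bounded_partitions_def card_image[OF inj_on_bead])
  qed
qed

text \<open>Each n-subset of \<open>{..<K}\<close> is enumerated by the beads of its partition, so
  Cauchy--Binet becomes a sum over partitions.\<close>

lemma cauchy_binet_partitions: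
  fixes A B :: "nat \<Rightarrow> nat \<Rightarrow> 'a :: comm_ring_1"
  shows "det (mat n n (\<lambda>(i, j). \<Sum>t<K. A t i * B t j)) =
    (\<Sum>l\<in>bounded_partitions n K.
       det (mat n n (\<lambda>(i, j). A (bead n l i) j)) * det (mat n n (\<lambda>(i, j). B (bead n l i) j)))"
proof -
  let ?b = "\<lambda>l. bead n l ` {0..<n}" and ?P = "bounded_partitions n K"
  let ?g = "\<lambda>S. bead n (inv_into ?P ?b S)"
  note bij = bij_betw_bead_set[of n K]
  have g: "bij_betw (?g S) {0..<n} S" if "S \<subseteq> {..<K}" "card S = n" for S
  proof -
    have S: "S \<in> ?b ` ?P" using that bij_betw_imp_surj_on[OF bij] by blast
    have "inv_into ?P ?b S \<in> ?P" by (rule inv_into_into[OF S])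
    then have "inj_on (?g S) {0..<n}" by (simp add: bounded_partitions_def inj_on_bead)
    moreover have "?b (inv_into ?P ?b S) = S" by (rule f_inv_into_f[OF S])
    ultimately show ?thesis by (simp add: bij_betw_def)
  qed
  have inv: "inv_into ?P ?b (?b l) = l" if "l \<in> ?P" for l
    using bij_betw_imp_inj_on[OF bij] that by (rule inv_into_f_f)
  let ?H = "\<lambda>l. det (mat n n (\<lambda>(i, j). A (bead n l i) j)) * det (mat n n (\<lambda>(i, j). B (bead n l i) j))"
  have "det (mat n n (\<lambda>(i, j). \<Sum>t<K. A t i * B t j)) =
      (\<Sum>S | S \<subseteq> {..<K} \<and> card S = n. ?H (inv_into ?P ?b S))"
    by (rule cauchy_binet) (simp_all only: finite_lessThan g)
  also have "\<dots> = (\<Sum>l\<in>?P. ?H (inv_into ?P ?b (?b l)))"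
    by (rule sum.reindex_bij_betw[OF bij, symmetric])
  also have "\<dots> = (\<Sum>l\<in>?P. ?H l)"
    by (rule sum.cong[OF refl]) (simp only: inv)
  finally show ?thesis .
qed

section \<open>Jacobi--Trudi determinants\<close>

text \<open>Appending an empty row to the partition adds the last row (0, ..., 0, 1), because
  \<open>c\<close> vanishes at negative arguments; expansion along it leads back to the smaller
  matrix.\<close>

lemma det_jacobi_trudi_pad:
  fixes c :: "int \<Rightarrow> 'a :: comm_ring_1"
  assumes c0: "c 0 = 1" and cneg: "\<And>r. r < 0 \<Longrightarrow> c r = 0" and "length l \<le> n"
  shows "det (mat n n (\<lambda>(i, j). c (int (part l i) + int j - int i))) =
    det (mat (length l) (length l) (\<lambda>(i, j). c (int (l ! i) + int j - int i)))"
  using \<open>length l \<le> n\<close>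
proof (induction n rule: dec_induct)
  case base
  show ?case by (intro arg_cong[of _ _ det] eq_matI) (simp_all add: part_def)
next
  case (step n)
  let ?M = "\<lambda>n. mat n n (\<lambda>(i, j). c (int (part l i) + int j - int i))"
  have row: "?M (Suc n) $$ (n, j) = (if j = n then 1 else 0)" if "j < Suc n" for j
    using that step.hyps by (simp add: part_def c0 cneg)
  have "det (?M (Suc n)) = (\<Sum>j<Suc n. ?M (Suc n) $$ (n, j) * cofactor (?M (Suc n)) n j)"
    by (rule laplace_expansion_row) simp_all
  also have "\<dots> = (\<Sum>j<Suc n. if j = n then cofactor (?M (Suc n)) n n else 0)"
    by (rule sum.cong[OF refl]) (simp only: row lessThan_iff if_distrib[of "\<lambda>x. x * _"] mult_1_left mult_zero_left cong: if_cong)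
  also have "\<dots> = cofactor (?M (Suc n)) n n" by simp
  also have "\<dots> = det (?M n)"
  proof -
    have "mat_delete (?M (Suc n)) n n = ?M n"
      by (intro eq_matI) (simp_all add: mat_delete_def)
    then show ?thesis by (simp add: cofactor_def)
  qed
  finally show ?case using step.IH by simp
qed

text \<open>This is h_r at the n-th roots of unity, the coefficient of t^r in 1 / (1 - t^n).\<close>

definition divisibility_indicator :: "nat \<Rightarrow> int \<Rightarrow> int" where
  "divisibility_indicator n r = (if r \<ge> 0 \<and> int n dvd r then 1 else 0)"

lemma det_M_matrix:
  assumes "length l \<le> n"
  shows "det (M_matrix n l) =
    det (mat n n (\<lambda>(i, j). divisibility_indicator n (int (part l i) + int j - int i)))"
proof -
  have "M_matrix n l = mat (length l) (length l)
      (\<lambda>(i, j). divisibility_indicator n (int (l ! i) + int j - int i))"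
    by (intro eq_matI) (auto simp: M_matrix_def divisibility_indicator_def algebra_simps)
  then show ?thesis
    by (subst det_jacobi_trudi_pad[OF _ _ assms]) (simp_all add: divisibility_indicator_def)
qed

text \<open>An entry of the padded matrix depends only on its column and on the residue of the bead
  of its row, so congruent beads yield equal rows.\<close>

lemma inj_on_bead_mod:
  assumes n: "n > 0" and len: "length l \<le> n" and nz: "det (M_matrix n l) \<noteq> 0"
  shows "inj_on (\<lambda>i. bead n l i mod n) {0..<n}"
proof (rule inj_onI, rule ccontr)
  fix i j assume i: "i \<in> {0..<n}" and j: "j \<in> {0..<n}"
    and eq: "bead n l i mod n = bead n l j mod n" and ne: "i \<noteq> j"
  let ?A = "mat n n (\<lambda>(i, j). divisibility_indicator n (int (part l i) + int j - int i))"
  have entry: "divisibility_indicator n (int (part l i) + int q - int i) =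
      (if (int (bead n l i) mod int n + (int q + 1)) mod int n = 0 then 1 else 0)"
    if "i < n" for i q
  proof -
    have eq: "int (part l i) + int q - int i = int (bead n l i) + (int q + 1) - int n"
      using that by (simp add: bead_def of_nat_diff)
    have "(int (bead n l i) mod int n + (int q + 1)) mod int n = 0 \<longleftrightarrow>
        int n dvd int (part l i) + int q - int i"
      unfolding eq by (simp add: mod_simps dvd_eq_mod_eq_0)
    \<comment> \<open>Since i < n the index exceeds -n, and a multiple of \<open>n\<close> above -n
      is nonnegative.\<close>
    moreover have "int (part l i) + int q - int i \<ge> 0" if dvd: "int n dvd int (part l i) + int q - int i"
    proof (rule ccontr)
      assume "\<not> ?thesis"
      then have "int n \<le> - (int (part l i) + int q - int i)"
        using dvd by (intro zdvd_imp_le; simp only: dvd_minus_iff)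
      then show False using \<open>i < n\<close> by simp
    qed
    ultimately show ?thesis by (simp add: divisibility_indicator_def)
  qed
  have "int (bead n l i) mod int n = int (bead n l j) mod int n"
    using eq by (simp flip: of_nat_mod)
  then have "row ?A i = row ?A j"
    using i j by (intro eq_vecI) (simp_all add: entry)
  then have "det ?A = 0"
    using i j ne by (intro det_identical_rows[of _ n i j]) simp_all
  with nz show False using det_M_matrix[OF len] by simp
qed

section \<open>Removing border strips\<close>

text \<open>The largest bead \<open>b 0\<close> is moved down to \<open>b 0 - n = f 0 - 1\<close>. It comes to stand just below bead
  \<open>p\<close>, so the strip that is removed occupies the rows \<open>0, \<dots>, p\<close>.\<close>

locale bead_move =
  fixes f :: "nat \<Rightarrow> nat" and n :: nat
  assumes anti: "\<And>i. f (Suc i) \<le> f i" and zero: "\<And>i. i \<ge> n \<Longrightarrow> f i = 0"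
    and n_pos: "n > 0" and nonzero: "f 0 > 0"
    and inj: "inj_on (\<lambda>i. (f i + (n - 1 - i)) mod n) {0..<n}"
begin

definition b :: "nat \<Rightarrow> nat" where "b i = f i + (n - 1 - i)"

lemma f_mono: "i \<le> j \<Longrightarrow> f j \<le> f i"
  using lift_Suc_antimono_le[of f, OF anti] .

lemma b_less: "i < j \<Longrightarrow> j < n \<Longrightarrow> b j < b i"
  using f_mono[of i j] by (simp add: b_def)

lemma b_0: "b 0 - n = f 0 - 1" "n \<le> b 0" "b 0 = f 0 - 1 + n"
  using n_pos nonzero by (simp_all add: b_def)

lemma inj_b: "inj_on (\<lambda>i. b i mod n) {0..<n}"
  using inj by (simp only: b_def)

text \<open>A bead on the target position would be congruent to \<open>b 0\<close>, hence be
  \<open>b 0\<close> itself by \<open>inj_b\<close>; but the target lies \<open>n\<close>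
  lower.\<close>

lemma b_neq:
  assumes "i < n" shows "b i \<noteq> f 0 - 1"
proof
  assume eq: "b i = f 0 - 1"
  have "b i mod n = b 0 mod n" by (simp add: eq b_0(3))
  then have "i = 0" by (rule inj_onD[OF inj_b]) (use assms in simp_all)
  with eq b_0(3) n_pos show False by simp
qed

definition p :: nat where "p = (GREATEST i. i < n \<and> f 0 - 1 < b i)"

lemma p: "p < n" "f 0 - 1 < b p"
  and p_greatest: "i < n \<Longrightarrow> f 0 - 1 < b i \<Longrightarrow> i \<le> p"
proof -
  have ex: "0 < n \<and> f 0 - 1 < b 0" using n_pos b_0(3) by simp
  have bound: "\<And>i. i < n \<and> f 0 - 1 < b i \<Longrightarrow> i \<le> n" by simp
  show "p < n" "f 0 - 1 < b p"
    using GreatestI_nat[of "\<lambda>i. i < n \<and> f 0 - 1 < b i", OF ex bound] by (simp_all add: p_def)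
  show "i < n \<Longrightarrow> f 0 - 1 < b i \<Longrightarrow> i \<le> p"
    using Greatest_le_nat[of "\<lambda>i. i < n \<and> f 0 - 1 < b i" i n, OF _ bound] by (simp add: p_def)
qed

lemma b_small: "p < i \<Longrightarrow> i < n \<Longrightarrow> b i < f 0 - 1"
  using p_greatest[of i] b_neq[of i] by force

text \<open>If row \<open>p\<close> were empty, the beads from it on would fill all positions below \<open>b p\<close>.\<close>

lemma f_p_pos: "f p > 0"
proof (rule ccontr)
  assume "\<not> f p > 0"
  then have 0: "f i = 0" if "p \<le> i" for i using f_mono[OF that] by simp
  have "f 0 - 1 < n - 1 - p" using p(2) 0[of p] by (simp add: b_def)
  then have "n - 1 - (f 0 - 1) < n" "p \<le> n - 1 - (f 0 - 1)" "n - 1 - (n - 1 - (f 0 - 1)) = f 0 - 1"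
    by simp_all
  then show False using b_neq[of "n - 1 - (f 0 - 1)"] 0[of "n - 1 - (f 0 - 1)"] by (simp add: b_def)
qed

lemma f_pos: "i \<le> p \<Longrightarrow> f i > 0"
  using f_p_pos f_mono[of i p] by simp

text \<open>Thus \<open>f 0 + p - n\<close>, the length of row \<open>p\<close> after the move, is
  an exact subtraction, and row \<open>p\<close> really loses boxes.\<close>

lemma f_0_ge: "n \<le> f 0 + p" "f 0 + p - n < f p"
proof -
  show lt: "f 0 + p - n < f p"
    using p f_p_pos by (simp add: b_def)
  show "n \<le> f 0 + p"
  proof (cases "Suc p < n")
    case True
    have "n - 1 - Suc p \<le> b (Suc p)" by (simp add: b_def)
    with b_small[of "Suc p"] True show ?thesis by simp
  next
    case False
    then show ?thesis using p nonzero by simp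
  qed
qed

text \<open>The beads 1, ..., p move up by one row, where the staircase is higher by one: hence
  \<open>f (Suc i) - 1\<close>. Row \<open>p\<close> takes the moved bead.\<close>

definition h :: "nat \<Rightarrow> nat" where
  "h i = (if i < p then f (Suc i) - 1 else if i = p then f 0 + p - n else f i)"

lemma h_le: "h i \<le> f i"
  using anti[of i] f_0_ge(2) by (auto simp: h_def)

lemma f_Suc_p: "f (Suc p) \<le> f 0 + p - n"
proof (cases "Suc p < n")
  case True
  then show ?thesis using b_small[of "Suc p"] f_0_ge by (simp add: b_def)
next
  case False
  then show ?thesis using zero[of "Suc p"] by simp
qed

lemma h_anti: "h (Suc i) \<le> h i"
proof -
  consider "Suc i < p" | "Suc i = p" | "i = p" | "p < i" by linarith
  then show ?thesis
  proof cases
    case 1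
    then show ?thesis using anti[of "Suc i"] by (simp add: h_def)
  next
    case 2
    then show ?thesis using f_0_ge by (simp add: h_def)
  next
    case 3
    then show ?thesis using f_Suc_p by (simp add: h_def)
  qed (use anti in \<open>simp add: h_def\<close>)
qed

lemma h_zero: "i \<ge> n \<Longrightarrow> h i = 0"
  using p zero by (simp add: h_def)

lemma h_0: "h 0 < f 0"
  using anti[of 0] nonzero f_0_ge n_pos by (auto simp: h_def)

lemma beads: "h i + (n - 1 - i) =
    (if i < p then b (Suc i) else if i = p then b 0 - n else b i)"
  if "i < n"
  using that p f_0_ge f_pos[of "Suc i"] b_0(1) nonzero by (auto simp: h_def b_def)

text \<open>The new beads have the old residues, permuted by the cycle \<open>s\<close> on 0, ...,
  p, since \<open>b 0 - n\<close> is congruent to \<open>b 0\<close>.\<close>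

lemma h_inj: "inj_on (\<lambda>i. (h i + (n - 1 - i)) mod n) {0..<n}"
proof -
  define s where "s i = (if i < p then Suc i else if i = p then 0 else i)" for i
  have eq: "(h i + (n - 1 - i)) mod n = b (s i) mod n" if "i < n" for i
    using beads[OF that] b_0(2) by (simp add: s_def le_mod_geq)
  have "inj_on ((\<lambda>i. b i mod n) \<circ> s) {0..<n}"
  proof (rule comp_inj_on)
    show "inj_on s {0..<n}" by (auto simp: inj_on_def s_def)
    have "s ` {0..<n} \<subseteq> {0..<n}" using p by (auto simp: s_def)
    then show "inj_on (\<lambda>i. b i mod n) (s ` {0..<n})"
      by (rule inj_on_subset[OF inj_b])
  qed
  then show ?thesis
    by (subst inj_on_cong[where g = "(\<lambda>i. b i mod n) \<circ> s"])
      (simp_all only: eq atLeastLessThan_iff comp_apply)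
qed

text \<open>Each row i < p loses f i - f (i + 1) + 1 boxes. These losses telescope, and row
  \<open>p\<close> supplies the rest.\<close>

lemma sum_h: "(\<Sum>i<n. f i) = (\<Sum>i<n. h i) + n"
proof -
  have tele: "(\<Sum>i<q. int (f i) - int (h i)) = int (f 0) - int (f q) + int q" if "q \<le> p" for q
    using that
  proof (induction q)
    case (Suc q)
    then show ?case using f_pos[of "Suc q"] by (simp add: h_def)
  qed simp
  have "(\<Sum>i<n. int (f i) - int (h i)) = (\<Sum>i<Suc p. int (f i) - int (h i))"
    by (rule sum.mono_neutral_right) (use p in \<open>auto simp: h_def\<close>)
  also have "\<dots> = int n" using tele[of p] f_0_ge by (simp add: h_def)
  finally have "int (\<Sum>i<n. f i) = int ((\<Sum>i<n. h i) + n)" by (simp add: sum_subtractf)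
  then show ?thesis by linarith
qed

section \<open>The removed strip\<close>

definition D :: "box set" where "D = {(i, j). h i \<le> j \<and> j < f i}"

lemma D_row: "(i, j) \<in> D \<Longrightarrow> i \<le> p"
  by (rule ccontr) (simp add: D_def h_def)

lemma start_in_D: "(0, f 0 - 1) \<in> D"
  using h_0 by (simp add: D_def)

lemma D_col: "(i, j) \<in> D \<Longrightarrow> j \<le> f 0 - 1"
  using f_mono[of 0 i] by (auto simp: D_def)

lemma starting_box_D: "starting_box D = (0, f 0 - 1)"
  by (rule starting_box_eqI[OF start_in_D]) (auto dest: D_col)

lemma D_Sigma: "D = Sigma {..<n} (\<lambda>i. {h i..<f i})"
proof (intro equalityI subsetI)
  fix x assume "x \<in> D"
  then show "x \<in> Sigma {..<n} (\<lambda>i. {h i..<f i})"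
    using D_row[of "fst x" "snd x"] p by (cases x) (simp add: D_def)
qed (auto simp: D_def)

lemma card_D: "card D = n"
proof -
  have "card D = (\<Sum>i<n. f i - h i)" by (simp add: D_Sigma)
  also have "\<dots> = (\<Sum>i<n. f i) - (\<Sum>i<n. h i)" by (rule sum_subtractf_nat) (simp add: h_le)
  finally show ?thesis by (simp add: sum_h)
qed

text \<open>The path goes right to the end of the row and then up. Above the last box of row i + 1
  lies the first box of row i, as h i = f (i + 1) - 1. Each step lowers the measure.\<close>

lemma path_to_start:
  "(i, j) \<in> D \<Longrightarrow> ((i, j), (0, f 0 - 1)) \<in> {(x, y). x \<in> D \<and> y \<in> D \<and> adjacent x y}\<^sup>*"
proof (induction "i + (f 0 - j)" arbitrary: i j rule: less_induct)
  case less
  let ?R = "{(x, y). x \<in> D \<and> y \<in> D \<and> adjacent x y}"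
  have j: "h i \<le> j" "j < f i" using less.prems by (simp_all add: D_def)
  consider "Suc j < f i" | "Suc j = f i" "i = 0" | i' where "Suc j = f i" "i = Suc i'"
    using j(2) by (metis Suc_lessI not0_implies_Suc)
  then show ?case
  proof cases
    case 1
    then have in_D: "(i, Suc j) \<in> D" using j by (simp add: D_def)
    have "((i, Suc j), (0, f 0 - 1)) \<in> ?R\<^sup>*"
      using 1 f_mono[of 0 i] in_D by (intro less.hyps) simp_all
    moreover have "((i, j), (i, Suc j)) \<in> ?R" using in_D less.prems by (simp add: adjacent_def)
    ultimately show ?thesis by (rule converse_rtrancl_into_rtrancl[rotated])
  next
    case 2
    then have "j = f 0 - 1" by simp
    then show ?thesis using 2 by simp
  next
    case 3
    have "i' < p" using D_row[OF less.prems] 3 by simp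
    then have in_D: "(i', j) \<in> D"
      using 3 j anti[of i'] by (simp add: D_def h_def)
    have "((i', j), (0, f 0 - 1)) \<in> ?R\<^sup>*"
      using 3 in_D by (intro less.hyps) simp_all
    moreover have "((i, j), (i', j)) \<in> ?R" using in_D less.prems 3 by (simp add: adjacent_def)
    ultimately show ?thesis by (rule converse_rtrancl_into_rtrancl[rotated])
  qed
qed

lemma border_strip_D: "border_strip n D"
  unfolding border_strip_def
proof (intro conjI)
  show "finite D" by (simp add: D_Sigma)
  show "card D = n" by (rule card_D)
  show "connected_boxes D"
    unfolding connected_boxes_def
  proof (intro ballI)
    let ?R = "{(x, y). x \<in> D \<and> y \<in> D \<and> adjacent x y}"
    have sym: "sym (?R\<^sup>*)" by (rule sym_rtrancl) (auto simp: sym_def adjacent_def)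
    fix x y assume "x \<in> D" "y \<in> D"
    then have "(x, (0, f 0 - 1)) \<in> ?R\<^sup>*" "(y, (0, f 0 - 1)) \<in> ?R\<^sup>*"
      using path_to_start[of "fst x" "snd x"] path_to_start[of "fst y" "snd y"] by simp_all
    then show "(x, y) \<in> ?R\<^sup>*" by (rule rtrancl_trans[OF _ symD[OF sym]])
  qed
  show "\<not> (\<exists>i j. {(i, j), (i, Suc j), (Suc i, j), (Suc i, Suc j)} \<subseteq> D)"
  proof
    assume "\<exists>i j. {(i, j), (i, Suc j), (Suc i, j), (Suc i, Suc j)} \<subseteq> D"
    then obtain i j where ij: "(i, j) \<in> D" "(Suc i, Suc j) \<in> D" by blast
    then have "i < p" using D_row[of "Suc i"] by force
    \<comment> \<open>Row \<open>i\<close> starts in the column where row i + 1 ends, so the two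
      rows share just one column.\<close>
    then have "f (Suc i) - 1 \<le> j" "Suc j < f (Suc i)" using ij by (auto simp: D_def h_def)
    then show False by linarith
  qed
qed

end

section \<open>Chains of removed strips\<close>

lemma diagram_eq: "diagram l = {(i, j). j < part l i}"
  by (auto simp: diagram_def part_def split: if_splits)

lemma remove_first_strip:
  assumes l: "is_partition l" "length l \<le> n" "l \<noteq> []" and n: "n > 0"
    and inj: "inj_on (\<lambda>i. bead n l i mod n) {0..<n}"
  shows "\<exists>m. is_partition m \<and> length m \<le> n \<and> inj_on (\<lambda>i. bead n m i mod n) {0..<n} \<and>
    sum_list l = sum_list m + n \<and> diagram m \<subseteq> diagram l \<and> part m 0 < part l 0 \<and>
    border_strip n (skew_diagram l m) \<and> starting_box (skew_diagram l m) = (0, part l 0 - 1)"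
proof -
  interpret bead_move "part l" n
  proof
    show "part l (Suc i) \<le> part l i" for i using l(1) by (simp add: part_antimono)
    show "part l i = 0" if "n \<le> i" for i using l(2) that by (simp add: part_def)
    show "0 < part l 0" using l by (simp add: part_pos_iff)
    show "inj_on (\<lambda>i. (part l i + (n - 1 - i)) mod n) {0..<n}"
      using inj by (simp only: bead_def)
  qed (rule n)
  obtain m where m: "is_partition m" "length m \<le> n" "part m = h"
    using partition_of_fun[of h n, OF h_anti h_zero[OF order_refl]] by blast
  have "skew_diagram l m = D"
    by (auto simp: skew_diagram_def diagram_eq m D_def)
  moreover have "inj_on (\<lambda>i. bead n m i mod n) {0..<n}"
    using h_inj by (simp add: bead_def m)
  moreover have "diagram m \<subseteq> diagram l"
    using h_le by (auto simp: diagram_eq m intro: less_le_trans)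
  moreover have "sum_list l = sum_list m + n"
    using sum_h by (simp add: sum_list_part[OF l(2)] sum_list_part[OF m(2)] m)
  ultimately show ?thesis
    using m border_strip_D starting_box_D h_0 by auto
qed

text \<open>All strips of the chain start in the first row, where every box is the top of its column
  and \<open>southwest\<close> reduces to strict growth of the first part.\<close>

lemma horizontal_border_strip_empty:
  assumes "n > 0" "is_partition l" "length l \<le> n" "sum_list l = n * k"
    and "inj_on (\<lambda>i. bead n l i mod n) {0..<n}"
  shows "horizontal_border_strip n k l []"
proof -
  have top: "(0, j) \<in> top_boxes (skew_diagram l [])" if "j < part l 0" for j l
    using that by (simp add: top_boxes_def skew_diagram_def diagram_eq) (simp add: part_def)
  \<comment> \<open>The invariant records explicit starting boxes instead of
    \<open>top_boxes\<close>, which refers to the final shape and would change during the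
    induction.\<close>
  have "\<exists>\<alpha>. \<alpha> 0 = [] \<and> \<alpha> k = l \<and> (\<forall>i\<le>k. is_partition (\<alpha> i)) \<and>
      (\<forall>i\<in>{1..k}. diagram (\<alpha> (i - 1)) \<subseteq> diagram (\<alpha> i) \<and>
        border_strip n (skew_diagram (\<alpha> i) (\<alpha> (i - 1))) \<and>
        starting_box (skew_diagram (\<alpha> i) (\<alpha> (i - 1))) = (0, part (\<alpha> i) 0 - 1) \<and>
        part (\<alpha> (i - 1)) 0 < part (\<alpha> i) 0)"
    using assms(2-5)
  proof (induction k arbitrary: l)
    case 0
    then have "l = []" by (cases l) (auto simp: is_partition_def)
    then show ?case by (intro exI[of _ "\<lambda>_. []"]) (simp add: is_partition_def)
  next
    case (Suc k)
    then have "l \<noteq> []" using \<open>n > 0\<close> by auto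
    then obtain m where m: "is_partition m" "length m \<le> n" "inj_on (\<lambda>i. bead n m i mod n) {0..<n}"
      "sum_list l = sum_list m + n" "diagram m \<subseteq> diagram l" "part m 0 < part l 0"
      "border_strip n (skew_diagram l m)" "starting_box (skew_diagram l m) = (0, part l 0 - 1)"
      using remove_first_strip[of l n] Suc.prems \<open>n > 0\<close> by blast
    have "sum_list m = n * k" using m(4) Suc.prems(3) by simp
    then obtain \<alpha> where \<alpha>: "\<alpha> 0 = []" "\<alpha> k = m" "\<forall>i\<le>k. is_partition (\<alpha> i)"
      "\<forall>i\<in>{1..k}. diagram (\<alpha> (i - 1)) \<subseteq> diagram (\<alpha> i) \<and>
        border_strip n (skew_diagram (\<alpha> i) (\<alpha> (i - 1))) \<and>
        starting_box (skew_diagram (\<alpha> i) (\<alpha> (i - 1))) = (0, part (\<alpha> i) 0 - 1) \<and>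
        part (\<alpha> (i - 1)) 0 < part (\<alpha> i) 0"
      using Suc.IH[OF m(1,2) _ m(3)] by blast
    show ?case
    proof (intro exI[of _ "\<alpha>(Suc k := l)"] conjI ballI)
      fix i assume i: "i \<in> {1..Suc k}"
      let ?\<beta> = "\<alpha>(Suc k := l)"
      have *: "diagram (?\<beta> (i - 1)) \<subseteq> diagram (?\<beta> i) \<and>
        border_strip n (skew_diagram (?\<beta> i) (?\<beta> (i - 1))) \<and>
        starting_box (skew_diagram (?\<beta> i) (?\<beta> (i - 1))) = (0, part (?\<beta> i) 0 - 1) \<and>
        part (?\<beta> (i - 1)) 0 < part (?\<beta> i) 0"
      proof (cases "i = Suc k")
        case True
        then show ?thesis using \<alpha>(2) m by simp
      next
        case False
        then have "i \<in> {1..k}" "i - 1 \<noteq> Suc k" using i by auto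
        then show ?thesis using bspec[OF \<alpha>(4), of i] False by simp
      qed
      then show "diagram (?\<beta> (i - 1)) \<subseteq> diagram (?\<beta> i)"
        "border_strip n (skew_diagram (?\<beta> i) (?\<beta> (i - 1)))"
        "starting_box (skew_diagram (?\<beta> i) (?\<beta> (i - 1))) = (0, part (?\<beta> i) 0 - 1)"
        "part (?\<beta> (i - 1)) 0 < part (?\<beta> i) 0" by blast+
    qed (use \<alpha> Suc.prems in \<open>simp_all add: le_Suc_eq\<close>)
  qed
  then obtain \<alpha> where \<alpha>: "\<alpha> 0 = []" "\<alpha> k = l" "\<forall>i\<le>k. is_partition (\<alpha> i)"
    and step: "\<And>i. i \<in> {1..k} \<Longrightarrow> diagram (\<alpha> (i - 1)) \<subseteq> diagram (\<alpha> i) \<and>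
        border_strip n (skew_diagram (\<alpha> i) (\<alpha> (i - 1))) \<and>
        starting_box (skew_diagram (\<alpha> i) (\<alpha> (i - 1))) = (0, part (\<alpha> i) 0 - 1) \<and>
        part (\<alpha> (i - 1)) 0 < part (\<alpha> i) 0"
    by blast
  have less: "part (\<alpha> i) 0 < part (\<alpha> j) 0" if "i < j" "j \<le> k" for i j
    using that
  proof (induction j)
    case (Suc j)
    then show ?case using step[of "Suc j"] by (cases "i = j") auto
  qed simp
  show ?thesis
    unfolding horizontal_border_strip_def
  proof (intro exI[of _ \<alpha>] conjI ballI impI)
    fix i assume i: "i \<in> {1..k}"
    show "diagram (\<alpha> (i - 1)) \<subseteq> diagram (\<alpha> i)"
      "border_strip n (skew_diagram (\<alpha> i) (\<alpha> (i - 1)))"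
      using step[OF i] by blast+
    have "part (\<alpha> i) 0 \<le> part l 0" using less[of i k] \<alpha> i by (cases "i = k") simp_all
    then have "part (\<alpha> i) 0 - 1 < part l 0" using step[OF i] by linarith
    then show "starting_box (skew_diagram (\<alpha> i) (\<alpha> (i - 1))) \<in> top_boxes (skew_diagram l [])"
      using step[OF i] top by simp
    fix j assume j: "j \<in> {1..k}" and "i < j"
    then have "part (\<alpha> i) 0 - 1 < part (\<alpha> j) 0 - 1"
      using less[of i j] step[OF i] by auto
    then show "southwest (starting_box (skew_diagram (\<alpha> i) (\<alpha> (i - 1))))
        (starting_box (skew_diagram (\<alpha> j) (\<alpha> (j - 1))))"
      using step[OF i] step[OF j] by (simp add: southwest_def)
  qed (use \<alpha> in simp_all)
qed

section \<open>Homogeneity and the dual Cauchy identity\<close>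

text \<open>Degrees are integers to cover \<open>elem_sym r\<close> for negative \<open>r\<close>;
  the zero function is homogeneous of every degree.\<close>

definition homogeneous :: "int \<Rightarrow> symfun \<Rightarrow> bool" where
  "homogeneous d f \<longleftrightarrow> (\<forall>m. coefficient f m \<noteq> 0 \<longrightarrow> int (monomial_degree m) = d)"

lemma coefficient_sum: "coefficient (sum f A) m = (\<Sum>a\<in>A. coefficient (f a) m)"
  by (induction A rule: infinite_finite_induct) (simp_all add: zero_symfun.rep_eq plus_symfun.rep_eq)

lemma homogeneous_uminus: "homogeneous d f \<Longrightarrow> homogeneous d (- f)"
  by (simp add: homogeneous_def uminus_symfun.rep_eq)

lemma homogeneous_sum: "(\<And>a. a \<in> A \<Longrightarrow> homogeneous d (f a)) \<Longrightarrow> homogeneous d (sum f A)"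
  unfolding homogeneous_def coefficient_sum by (meson sum.not_neutral_contains_not_neutral)

lemma homogeneous_minus_one_power: "homogeneous d f \<Longrightarrow> homogeneous d ((- 1) ^ j * f)"
  by (simp add: minus_one_power_iff homogeneous_uminus)

lemma homogeneous_one: "homogeneous 0 1"
  by (simp add: homogeneous_def one_symfun.rep_eq monomial_degree_def)

lemma homogeneous_mult:
  assumes f: "homogeneous d f" and g: "homogeneous e g"
  shows "homogeneous (d + e) (f * g)"
  unfolding homogeneous_def
proof (intro allI impI)
  fix m assume "coefficient (f * g) m \<noteq> 0"
  then obtain q where "q \<in> {(a, b). a + b = m}" "(case q of (a, b) \<Rightarrow> coefficient f a * coefficient g b) \<noteq> 0"
    unfolding times_symfun.rep_eq series_mult_def by (rule sum.not_neutral_contains_not_neutral)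
  then obtain a b where "a + b = m" "coefficient f a \<noteq> 0" "coefficient g b \<noteq> 0"
    by auto
  with f g show "int (monomial_degree m) = d + e"
    by (auto simp: homogeneous_def monomial_degree_plus)
qed

lemma homogeneous_prod:
  "(\<And>a. a \<in> A \<Longrightarrow> homogeneous (d a) (f a)) \<Longrightarrow> homogeneous (sum d A) (prod f A)"
  by (induction A rule: infinite_finite_induct) (simp_all add: homogeneous_one homogeneous_mult)

lemma homogeneous_of_int_mult: "homogeneous d f \<Longrightarrow> homogeneous d (of_int c * f)"
proof -
  have "coefficient (of_nat c * f) m = int c * coefficient f m" for c m
    by (induction c) (simp_all add: distrib_right zero_symfun.rep_eq plus_symfun.rep_eq)
  then have "coefficient (of_int c * f) m = c * coefficient f m" for m
    by (cases c rule: int_cases2) (simp_all add: uminus_symfun.rep_eq)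
  then show "homogeneous d f \<Longrightarrow> homogeneous d (of_int c * f)"
    by (simp add: homogeneous_def)
qed

lemma homogeneous_elem_sym: "homogeneous r (elem_sym r)"
proof -
  have "monomial_degree m = card (Poly_Mapping.keys m)" 
    if le: "\<forall>i. Poly_Mapping.lookup m i \<le> 1" for m
  proof -
    have "Poly_Mapping.lookup m i = 1" if "i \<in> Poly_Mapping.keys m" for i
      using that spec[OF le, of i] by (simp add: in_keys_iff)
    then show ?thesis by (simp add: monomial_degree_def)
  qed
  then show ?thesis by (simp add: homogeneous_def elem_sym.rep_eq)
qed

lemma homogeneous_power_sum_plethysm:
  assumes "homogeneous d f" shows "homogeneous (int n * d) (power_sum_plethysm n f)"
  unfolding homogeneous_def
proof (intro allI impI)
  fix m assume "coefficient (power_sum_plethysm n f) m \<noteq> 0"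
  then obtain a where "a \<in> {a. monomial_power n a = m}" "coefficient f a \<noteq> 0"
    unfolding power_sum_plethysm.rep_eq by (rule sum.not_neutral_contains_not_neutral)
  with assms show "int (monomial_degree m) = int n * d"
    by (auto simp: homogeneous_def monomial_degree_monomial_power)
qed

text \<open>The degrees in a Leibniz term add up to the sum of all l_i + p(i) - i, where the sums of
  p(i) and of i cancel.\<close>

lemma homogeneous_det_elem_matrix: "homogeneous (int (sum_list l)) (det (elem_matrix l))"
proof -
  let ?n = "length l"
  have "homogeneous (int (sum_list l)) (signof p * (\<Prod>i = 0..<?n. elem_matrix l $$ (i, p i)))"
    if p: "p permutes {0..<?n}" for p
  proof -
    have "(\<Prod>i = 0..<?n. elem_matrix l $$ (i, p i)) =
        (\<Prod>i = 0..<?n. elem_sym (int (l ! i) + int (p i) - int i))"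
      using permutes_in_image[OF p] by (intro prod.cong) (simp_all add: elem_matrix_def)
    moreover have "(\<Sum>i = 0..<?n. int (l ! i) + int (p i) - int i) = int (sum_list l)"
      using sum.permute[OF p, of int] by (simp add: sum_subtractf sum.distrib sum_list_sum_nth comp_def)
    ultimately have "homogeneous (int (sum_list l)) (\<Prod>i = 0..<?n. elem_matrix l $$ (i, p i))"
      using homogeneous_prod[of "{0..<?n}" "\<lambda>i. int (l ! i) + int (p i) - int i"
          "\<lambda>i. elem_sym (int (l ! i) + int (p i) - int i)", OF homogeneous_elem_sym] by (simp only:)
    then show ?thesis by (rule homogeneous_of_int_mult)
  qed
  then show ?thesis
    by (subst det_def'[of _ ?n]) (auto simp: elem_matrix_def intro!: homogeneous_sum)
qed

text \<open>This splits E(P) into values h_r at the roots of unity and e_r, with \<open>t\<close> a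
  bead position. In row \<open>i\<close> only t = q n + (n - 1 - i) contributes, and it turns the
  second index into q n + j - i.\<close>

lemma residue_matrix_eq:
  fixes x :: "nat \<Rightarrow> 'a :: comm_ring_1"
  assumes n: "n > 0"
  shows "residue_matrix n x Q N = mat n n (\<lambda>(i, j). \<Sum>t<Q * n.
    of_int (divisibility_indicator n (int t + int i - int (n - 1))) *
    elem_rec x N (int t + int j - int (n - 1)))"
    (is "_ = ?B")
proof (rule eq_matI)
  fix i j assume "i < dim_row ?B" "j < dim_col ?B"
  then have i: "i < n" and j: "j < n" by simp_all
  let ?t = "\<lambda>q. q * n + (n - 1 - i)"
  let ?S = "\<lambda>t. of_int (divisibility_indicator n (int t + int i - int (n - 1))) *
    elem_rec x N (int t + int j - int (n - 1))"
  have shift: "int (?t q) + int i - int (n - 1) = int (q * n)" for q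
    using i by (simp add: of_nat_diff)
  have "(\<Sum>t<Q * n. ?S t) = (\<Sum>t\<in>?t ` {..<Q}. ?S t)"
  proof (rule sum.mono_neutral_right)
    show "?t ` {..<Q} \<subseteq> {..<Q * n}"
    proof safe
      fix q assume "q < Q"
      then have "Suc q * n \<le> Q * n" by (intro mult_le_mono1) simp
      then show "?t q < Q * n" using n by simp
    qed
    show "\<forall>t\<in>{..<Q * n} - ?t ` {..<Q}. ?S t = 0"
    proof
      fix t assume t: "t \<in> {..<Q * n} - ?t ` {..<Q}"
      have "\<not> (int t + int i - int (n - 1) \<ge> 0 \<and> int n dvd int t + int i - int (n - 1))"
      proof
        assume *: "int t + int i - int (n - 1) \<ge> 0 \<and> int n dvd int t + int i - int (n - 1)"
        then obtain q where q: "int t + int i - int (n - 1) = int n * q" by (auto elim: dvdE)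
        with * have "0 \<le> int n * q" by linarith
        then have "q \<ge> 0" using n by (simp add: zero_le_mult_iff)
        then have "int t = int (?t (nat q))" using q i by (simp add: of_nat_diff mult.commute)
        then have tq: "t = ?t (nat q)" by (simp only: of_nat_eq_iff)
        have "t < Q * n" using t by simp
        then have "nat q * n < Q * n" using tq by linarith
        then have "nat q < Q" by simp
        with tq t show False by blast
      qed
      then have "divisibility_indicator n (int t + int i - int (n - 1)) = 0"
        by (simp only: divisibility_indicator_def if_False)
      then show "?S t = 0" by (simp only: of_int_0 mult_zero_left)
    qed
  qed simp
  also have "\<dots> = (\<Sum>q<Q. ?S (?t q))"
    using n by (subst sum.reindex) (auto simp: inj_on_def)
  also have "\<dots> = (\<Sum>q<Q. elem_rec x N (int (q * n) + int j - int i))"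
  proof (rule sum.cong[OF refl])
    fix q
    have eq: "int (?t q) + int j - int (n - 1) = int (q * n) + int j - int i"
      using shift[of q] by linarith
    have "divisibility_indicator n (int (q * n)) = 1" by (simp add: divisibility_indicator_def)
    then show "?S (?t q) = elem_rec x N (int (q * n) + int j - int i)"
      by (simp only: shift eq of_int_1 mult_1_left)
  qed
  finally show "residue_matrix n x Q N $$ (i, j) = ?B $$ (i, j)"
    using i j by (simp add: residue_matrix_def)
qed (simp_all add: residue_matrix_def)

text \<open>Both sides are the determinant of \<open>residue_matrix\<close>, computed by
  Cauchy--Binet and by the product formula. All degrees are still mixed here.\<close>

lemma restrict_vars_dual_cauchy:
  assumes n: "n > 0" and Q: "N < Q"
  shows "restrict_vars N (\<Sum>l\<in>bounded_partitions n (Q * n). of_int (det (M_matrix n l)) * det (elem_matrix l)) =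
    restrict_vars N (\<Sum>r<Q. ((- 1) ^ (n - 1)) ^ r * power_sum_plethysm n (elem_sym (int r)))"
proof -
  define x where "x = (\<lambda>i. mseries_monomial (Poly_Mapping.single i 1))"
  have e: "elem_rec x N r = restrict_vars N (elem_sym r)" for r
    by (simp add: restrict_vars_elem_sym x_def)
  have summand: "det (mat n n (\<lambda>(i, j). of_int (divisibility_indicator n (int (bead n l i) + int j - int (n - 1))))) *
      det (mat n n (\<lambda>(i, j). elem_rec x N (int (bead n l i) + int j - int (n - 1)))) =
      restrict_vars N (of_int (det (M_matrix n l)) * det (elem_matrix l))"
    if "l \<in> bounded_partitions n (Q * n)" for l
  proof -
    have len: "length l \<le> n" using that by (simp add: bounded_partitions_def)
    have bead: "int (bead n l i) + int j - int (n - Suc 0) = int (part l i) + int j - int i" if "i < n" for i j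
      using that by (simp add: bead_def of_nat_diff)
    have "mat n n (\<lambda>(i, j). of_int (divisibility_indicator n (int (bead n l i) + int j - int (n - 1)))) =
        map_mat (of_int :: int \<Rightarrow> mseries)
          (mat n n (\<lambda>(i, j). divisibility_indicator n (int (part l i) + int j - int i)))"
      by (intro eq_matI) (simp_all add: bead del: of_nat_diff)
    then have 1: "det (mat n n (\<lambda>(i, j). of_int (divisibility_indicator n (int (bead n l i) + int j - int (n - 1))))) =
        (of_int (det (M_matrix n l)) :: mseries)"
      by (simp add: det_M_matrix[OF len])
    have "mat n n (\<lambda>(i, j). elem_rec x N (int (bead n l i) + int j - int (n - 1))) =
        mat n n (\<lambda>(i, j). elem_rec x N (int (part l i) + int j - int i))"
      by (intro eq_matI) (simp_all add: bead del: of_nat_diff)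
    then have "det (mat n n (\<lambda>(i, j). elem_rec x N (int (bead n l i) + int j - int (n - 1)))) =
        det (mat (length l) (length l) (\<lambda>(i, j). elem_rec x N (int (l ! i) + int j - int i)))"
      by (simp only:) (rule det_jacobi_trudi_pad[OF _ _ len], simp_all add: e elem_sym_0 elem_sym_neg)
    also have "mat (length l) (length l) (\<lambda>(i, j). elem_rec x N (int (l ! i) + int j - int i)) =
        map_mat (restrict_vars N) (elem_matrix l)"
      by (intro eq_matI) (simp_all add: elem_matrix_def e)
    finally have 2: "det (mat n n (\<lambda>(i, j). elem_rec x N (int (bead n l i) + int j - int (n - 1)))) =
        restrict_vars N (det (elem_matrix l))"
      by simp
    show ?thesis unfolding 1 2 by (simp add: restrict_vars.hom_mult restrict_vars.hom_of_int)
  qed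
  have "det (residue_matrix n x Q N) =
      (\<Sum>l\<in>bounded_partitions n (Q * n). restrict_vars N (of_int (det (M_matrix n l)) * det (elem_matrix l)))"
    unfolding residue_matrix_eq[OF n] cauchy_binet_partitions
    by (rule sum.cong[OF refl]) (rule summand)
  \<comment> \<open>The product is the generating polynomial of the e_r in the variables x_i^n,
    taken at s = (-1)^(n-1).\<close>
  moreover have "det (residue_matrix n x Q N) =
      (\<Sum>r<Q. ((- 1) ^ (n - 1)) ^ r * restrict_vars N (power_sum_plethysm n (elem_sym (int r))))"
    unfolding det_residue_matrix[OF n Q] restrict_vars_plethysm[OF n] x_def
    by (rule elem_rec_generating[OF Q, symmetric])
  ultimately show ?thesis
    by (simp add: restrict_vars.hom_sum restrict_vars.hom_mult restrict_vars.hom_power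
        restrict_vars.hom_uminus)
qed

section \<open>Comparison in degree n k\<close>

lemma symfun_eqI: "(\<And>m. coefficient f m = coefficient g m) \<Longrightarrow> f = g"
  by (metis coefficient_inject ext)

theorem corollary3p12:
  fixes n k :: nat
  assumes "n > 0" and "k > 0"
  shows "power_sum_plethysm n (elem_sym (int k)) =
    (- 1) ^ (k * (n - 1)) *
    (\<Sum>l | is_partition_of l (n * k) \<and> length l \<le> n \<and> horizontal_border_strip n k l [].
       of_int (det (M_matrix n l)) * det (elem_matrix l))"
proof -
  let ?R = "{l. is_partition_of l (n * k) \<and> length l \<le> n \<and> horizontal_border_strip n k l []}"
  define H where "H l = of_int (det (M_matrix n l)) * det (elem_matrix l)" for l
  \<comment> \<open>The part of degree n r on the product side, with its sign.\<close>
  define G where "G r = ((- 1) ^ (n - 1)) ^ r * power_sum_plethysm n (elem_sym (int r))" for r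
  have H_hom: "homogeneous (int (sum_list l)) (H l)" for l
    unfolding H_def by (rule homogeneous_of_int_mult[OF homogeneous_det_elem_matrix])
  have G_hom: "homogeneous (int (n * r)) (G r)" for r
    unfolding G_def power_mult[symmetric] of_nat_mult
    by (intro homogeneous_minus_one_power homogeneous_power_sum_plethysm homogeneous_elem_sym)
  have "G k = sum H ?R"
  proof (rule symfun_eqI)
    fix m
    show "coefficient (G k) m = coefficient (sum H ?R) m"
    proof (cases "monomial_degree m = n * k")
      \<comment> \<open>Both sides are homogeneous of degree n k, so this coefficient is 0 on
        each.\<close>
      case False
      have "homogeneous (int (n * k)) (sum H ?R)"
      proof (rule homogeneous_sum)
        fix l assume "l \<in> ?R"
        then have "sum_list l = n * k" by (simp add: is_partition_of_def)
        then show "homogeneous (int (n * k)) (H l)" using H_hom[of l] by (simp only:)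
      qed
      then show ?thesis
        using False G_hom[of k] unfolding homogeneous_def by (metis of_nat_eq_iff)
    next
      case True
      obtain N where N: "Poly_Mapping.keys m \<subseteq> {..<N}"
        using finite_nat_iff_bounded[of "Poly_Mapping.keys m"] by auto
      \<comment> \<open>This exceeds \<open>N\<close>, as the truncation requires, and
        \<open>k\<close>, so that \<open>G k\<close> occurs; beads of partitions of n k stay below
        \<open>Q * n\<close>.\<close>
      define Q where "Q = N + k + 1"
      let ?P = "bounded_partitions n (Q * n)"
      have "coefficient (sum H ?P) m = coefficient (\<Sum>r<Q. G r) m"
        using arg_cong[OF restrict_vars_dual_cauchy[OF \<open>n > 0\<close>, of N Q], of "\<lambda>f. mcoeff f m"] N
        by (simp add: Q_def mcoeff_restrict_vars H_def G_def)
      also have "\<dots> = (\<Sum>r<Q. if r = k then coefficient (G k) m else 0)"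
        unfolding coefficient_sum
      proof (rule sum.cong[OF refl])
        fix r
        show "coefficient (G r) m = (if r = k then coefficient (G k) m else 0)"
          using G_hom[of r] True \<open>n > 0\<close> by (auto simp: homogeneous_def)
      qed
      also have "\<dots> = coefficient (G k) m" by (simp add: Q_def)
      also have "coefficient (sum H ?P) m = coefficient (sum H ?R) m"
        unfolding coefficient_sum
      proof (rule sum.mono_neutral_right)
        have "finite {S. S \<subseteq> {..<Q * n} \<and> card S = n}"
          by (rule finite_subset[of _ "Pow {..<Q * n}"]) auto
        then show "finite ?P" using bij_betw_finite[OF bij_betw_bead_set] by blast
        show "?R \<subseteq> ?P"
        proof
          fix l assume l: "l \<in> ?R"
          have "bead n l i < Q * n" if "i < n" for i
          proof -
            have "part l i \<le> n * k"
              using l member_le_sum_list[of "l ! i" l] by (auto simp: part_def is_partition_of_def)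
            then have "bead n l i < n * k + n" using that by (simp add: bead_def)
            also have "\<dots> \<le> Q * n" by (simp add: Q_def algebra_simps)
            finally show ?thesis .
          qed
          then show "l \<in> ?P" using l by (simp add: bounded_partitions_def is_partition_of_def)
        qed
        \<comment> \<open>A partition of the wrong size contributes nothing in this degree; one of
          the right size that is no horizontal strip has vanishing
          \<open>det (M_matrix n l)\<close>.\<close>
        show "\<forall>l\<in>?P - ?R. coefficient (H l) m = 0"
        proof
          fix l assume l: "l \<in> ?P - ?R"
          then have l': "is_partition l" "length l \<le> n" by (auto simp: bounded_partitions_def)
          show "coefficient (H l) m = 0"
          proof (cases "sum_list l = n * k")
            case False
            then show ?thesis using H_hom[of l] True unfolding homogeneous_def by (metis of_nat_eq_iff)
          next
            case size: True
            have "det (M_matrix n l) = 0"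
              using horizontal_border_strip_empty[OF \<open>n > 0\<close> l' size]
                inj_on_bead_mod[OF \<open>n > 0\<close> l'(2)] l l' size by (auto simp: is_partition_of_def)
            then show ?thesis by (simp add: H_def zero_symfun.rep_eq)
          qed
        qed
      qed
      finally show ?thesis by simp
    qed
  qed
  \<comment> \<open>The sign occurs a second time inside \<open>G k\<close>, and its square is
    1.\<close>
  moreover have "(- 1) ^ (k * (n - 1)) * G k = power_sum_plethysm n (elem_sym (int k))"
    unfolding G_def power_mult[symmetric] mult.commute[of k] mult.assoc[symmetric] power_add[symmetric]
    by (simp flip: mult_2)
  ultimately show ?thesis by (simp add: H_def)
qed

end
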